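(* Let $n>k$, where $k\in\{2,3,4,5\}$. Let $G$ be a $k$-connected graph on $n$ vertices, and let $H\subset G$ be a minimum spanning $k$-connected subgraph. If $e(H)=\lceil\frac{kn}{2}\rceil$, then \[ mc_k(G)=e(G)-\left\lceil\frac{kn}{2}\right\rceil+1. \]
   Context: All graphs are finite, simple and undirected. A graph is $k$-connected if it has at least $k+1$ vertices and remains connected after deleting any at most $k-1$ vertices. Paths are called disjoint if they are internally vertex-disjoint. An edge-coloured path is monochromatic if all its edges have the same colour. For a $k$-connected graph $G$, an edge-colouring is monochromatic $k$-connected if any two vertices are connected by $k$ disjoint monochromatic paths; $mc_k(G)$ is the maximum number of colours in a monochromatic $k$-connected colouring of $G$. A minimum spanning $k$-connected subgraph of $G$ is a $k$-connected subgraph $H$ with $V(H)=V(G)$ and $e(H)$ minimum among such subgraphs. *)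

theory Defs
  imports Complex_Main
begin

definition graph :: "'a set \<Rightarrow> 'a set set \<Rightarrow> bool" where
  "graph V E \<longleftrightarrow> finite V \<and> (\<forall>e\<in>E. \<exists>x y. x \<noteq> y \<and> x \<in> V \<and> y \<in> V \<and> e = {x, y})"

definition is_path :: "'a set \<Rightarrow> 'a set set \<Rightarrow> 'a \<Rightarrow> 'a \<Rightarrow> 'a list \<Rightarrow> bool" where
  "is_path V E u v p \<longleftrightarrow> p \<noteq> [] \<and> hd p = u \<and> last p = v \<and> distinct p \<and> set p \<subseteq> V \<and>
     (\<forall>i. Suc i < length p \<longrightarrow> {p ! i, p ! Suc i} \<in> E)"

definition interior :: "'a list \<Rightarrow> 'a set" where
  "interior p = set (butlast (tl p))"

definition induced_edges :: "'a set set \<Rightarrow> 'a set \<Rightarrow> 'a set set" where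
  "induced_edges E W = {e \<in> E. e \<subseteq> W}"

definition connected_graph :: "'a set \<Rightarrow> 'a set set \<Rightarrow> bool" where
  "connected_graph V E \<longleftrightarrow> (\<forall>u\<in>V. \<forall>v\<in>V. \<exists>p. is_path V E u v p)"

definition k_connected :: "nat \<Rightarrow> 'a set \<Rightarrow> 'a set set \<Rightarrow> bool" where
  "k_connected k V E \<longleftrightarrow> card V \<ge> k + 1 \<and>
     (\<forall>S. S \<subseteq> V \<and> card S \<le> k - 1 \<longrightarrow> connected_graph (V - S) (induced_edges E (V - S)))"

definition monochromatic :: "('a set \<Rightarrow> 'c) \<Rightarrow> 'a list \<Rightarrow> bool" where
  "monochromatic c p \<longleftrightarrow> (\<forall>i j. Suc i < length p \<longrightarrow> Suc j < length p \<longrightarrow>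
      c {p ! i, p ! Suc i} = c {p ! j, p ! Suc j})"

text \<open>Edge colouring c (only its values on E matter) is monochromatic k-connected:
any two distinct vertices are joined by k internally disjoint monochromatic paths.\<close>
definition mono_k_connected_colouring :: "nat \<Rightarrow> 'a set \<Rightarrow> 'a set set \<Rightarrow> ('a set \<Rightarrow> 'c) \<Rightarrow> bool" where
  "mono_k_connected_colouring k V E c \<longleftrightarrow>
     (\<forall>u\<in>V. \<forall>v\<in>V. u \<noteq> v \<longrightarrow>
        (\<exists>P. finite P \<and> card P = k \<and>
             (\<forall>p\<in>P. is_path V E u v p \<and> monochromatic c p) \<and>
             (\<forall>p\<in>P. \<forall>q\<in>P. p \<noteq> q \<longrightarrow> interior p \<inter> interior q = {})))"

definition mc :: "nat \<Rightarrow> 'a set \<Rightarrow> 'a set set \<Rightarrow> nat" where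
  "mc k V E = Max {card (c ` E) | c :: 'a set \<Rightarrow> nat. mono_k_connected_colouring k V E c}"

definition min_spanning_k_connected :: "nat \<Rightarrow> 'a set \<Rightarrow> 'a set set \<Rightarrow> 'a set set \<Rightarrow> bool" where
  "min_spanning_k_connected k V E F \<longleftrightarrow> F \<subseteq> E \<and> k_connected k V F \<and>
     (\<forall>F'. F' \<subseteq> E \<and> k_connected k V F' \<longrightarrow> card F \<le> card F')"

end

theory Submission
  imports Defs
begin

text \<open>
  Lower bound: by Menger's theorem, giving all edges of \<open>F\<close> one colour and all other edges distinct
  new colours is a monochromatic \<open>k\<close>-connected colouring.

  Upper bound: splitting colours into connected components only increases their number, so let
  every colour class be connected, and call a colour trivial if it has one edge. A path of length
  at least two never has a trivial colour, so every vertex has degree at least \<open>k\<close> in the nontrivial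
  colours, and one has to show that the nontrivial colour classes satisfy
  \<open>\<Sum> 2 (e - 1) \<ge> k n - 2\<close>. If all these degrees exceed \<open>k\<close>, this follows by distributing
  \<open>2 (e - 1)\<close> over the vertices of each class. Otherwise some vertex \<open>u\<close> has degree exactly \<open>k\<close>,
  so the paths from \<open>u\<close> use all its edges; every vertex then has nearly the same degrees as \<open>u\<close>
  in the colours at \<open>u\<close>, and these colours are nearly spanning. Counting settles all cases but one:
  \<open>u\<close> sees exactly two colours, each at least twice. As \<open>k \<le> 5\<close>, one of them is then seen exactly
  twice, and in the extremal situation it forms a Hamilton cycle. Two disjoint paths in this cycle
  already cover all vertices and leave no room for paths of the other colour.
\<close>

section \<open>Degree counting\<close>

text \<open>
  An abstract record of a colouring: \<open>T\<close> is the set of colours with at least two edges, \<open>d i v\<close> the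
  degree of \<open>v\<close> in colour \<open>i\<close>, \<open>e i\<close> the number of edges of colour \<open>i\<close>, and \<open>N\<close> adjacency by an edge
  with colour in \<open>T\<close>. Colours with a single edge contribute at most one path, hence the
  \<open>k - 1\<close> in \<open>pair\<close>.
\<close>

locale degree_system =
  fixes V :: "'a set" and T :: "'i set" and d :: "'i \<Rightarrow> 'a \<Rightarrow> int" and e :: "'i \<Rightarrow> int"
    and N :: "'a \<Rightarrow> 'a \<Rightarrow> bool" and k :: int
  assumes finite_V: "finite V" and finite_T: "finite T"
    and k_ge: "2 \<le> k" and card_V: "k + 1 \<le> int (card V)"
    and d_nonneg: "0 \<le> d i v"
    and pair: "\<lbrakk>u \<in> V; v \<in> V; u \<noteq> v\<rbrakk> \<Longrightarrow> k - 1 \<le> (\<Sum>i\<in>T. min (d i u) (d i v))"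
    and adjacent: "\<lbrakk>u \<in> V; v \<in> V; N u v\<rbrakk> \<Longrightarrow> u \<noteq> v \<and> k \<le> (\<Sum>i\<in>T. min (d i u) (d i v))"
    and neighbours: "u \<in> V \<Longrightarrow> int (card {v \<in> V. N u v}) = (\<Sum>i\<in>T. d i u)"
    and handshake: "i \<in> T \<Longrightarrow> (\<Sum>v\<in>V. d i v) = 2 * e i"
    and support_ge: "i \<in> T \<Longrightarrow> 3 \<le> card {v \<in> V. 0 < d i v}"
    and support_le: "i \<in> T \<Longrightarrow> int (card {v \<in> V. 0 < d i v}) \<le> e i + 1"
begin

definition deg :: "'a \<Rightarrow> int" where "deg v = (\<Sum>i\<in>T. d i v)"

definition supp :: "'i \<Rightarrow> 'a set" where "supp i = {v \<in> V. 0 < d i v}"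

abbreviation n :: int where "n \<equiv> int (card V)"

lemma supp_subset: "supp i \<subseteq> V" by (auto simp: supp_def)

lemma finite_supp: "finite (supp i)"
  using finite_subset[OF supp_subset finite_V] .

lemma card_supp_le: "int (card (supp i)) \<le> n"
  using card_mono[OF finite_V supp_subset] by simp

lemma card_supp_ge: "i \<in> T \<Longrightarrow> 3 \<le> int (card (supp i))"
  using support_ge[of i] by (simp add: supp_def)

lemma card_supp_le_edges: "i \<in> T \<Longrightarrow> int (card (supp i)) \<le> e i + 1"
  using support_le[of i] by (simp add: supp_def)

lemma edges_ge: "i \<in> T \<Longrightarrow> 2 \<le> e i"
  using card_supp_ge card_supp_le_edges by fastforce

text \<open>As \<open>k - 1 \<ge> 1\<close>, \<open>pair\<close> makes the degree of
  \<open>u\<close> positive; hence \<open>u\<close> has a neighbour in the sense of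
  \<open>N\<close>, and \<open>adjacent\<close> improves the bound to \<open>k\<close>.\<close>

lemma deg_ge: assumes "u \<in> V" shows "k \<le> deg u"
proof -
  have "\<not> V \<subseteq> {u}"
    using card_V k_ge card_mono[of "{u}" V] by auto
  then obtain v where v: "v \<in> V" "v \<noteq> u" by auto
  have min_le: "(\<Sum>i\<in>T. min (d i u) (d i w)) \<le> deg u" for w
    unfolding deg_def by (intro sum_mono) auto
  have "0 < deg u" using pair[of u v] v assms min_le[of v] k_ge by auto
  then have "{w \<in> V. N u w} \<noteq> {}"
    using neighbours[OF assms] unfolding deg_def by fastforce
  then obtain w where "w \<in> V" "N u w" by auto
  then show ?thesis using adjacent[of u w] assms min_le[of w] by auto
qed

text \<open>Double counting of \<open>min (d i v) (d i w)\<close> over the vertices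
  \<open>w \<noteq> v\<close>: each \<open>w\<close> contributes at least \<open>k - 1\<close> and
  each of the \<open>deg v\<close> neighbours one more, while colour \<open>i\<close> contributes at
  most \<open>d i v\<close> per further vertex of its support.\<close>

lemma sum_support_ge:
  assumes v: "v \<in> V"
  shows "(k - 1) * (n - 1) + deg v \<le> (\<Sum>i\<in>T. d i v * (int (card (supp i)) - 1))"
proof -
  have "(k - 1) * (n - 1) + deg v = (\<Sum>w\<in>V - {v}. k - 1) + int (card {w \<in> V. N v w})"
    using neighbours[OF v] v finite_V card_V k_ge
    by (simp add: deg_def card_Diff_singleton of_nat_diff)
  also have "{w \<in> V. N v w} = {w \<in> V - {v}. N v w}"
    using adjacent[OF v] v by auto
  also have "int (card {w \<in> V - {v}. N v w}) = (\<Sum>w\<in>V - {v}. if N v w then 1 else 0)"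
    using finite_V by (subst sum.inter_filter[symmetric]) auto
  also have "(\<Sum>w\<in>V - {v}. k - 1) + (\<Sum>w\<in>V - {v}. if N v w then 1 else 0)
      = (\<Sum>w\<in>V - {v}. k - 1 + (if N v w then 1 else 0))"
    by (simp only: sum.distrib)
  also have "\<dots> \<le> (\<Sum>w\<in>V - {v}. \<Sum>i\<in>T. min (d i v) (d i w))"
    using pair[OF v] adjacent[OF v] by (intro sum_mono) auto
  also have "\<dots> = (\<Sum>i\<in>T. \<Sum>w\<in>V - {v}. min (d i v) (d i w))"
    by (rule sum.swap)
  also have "\<dots> \<le> (\<Sum>i\<in>T. d i v * (int (card (supp i)) - 1))"
  proof (intro sum_mono)
    fix i
    show "(\<Sum>w\<in>V - {v}. min (d i v) (d i w)) \<le> d i v * (int (card (supp i)) - 1)"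
    proof (cases "d i v = 0")
      case True
      then show ?thesis by (simp add: d_nonneg min_def)
    next
      case False
      then have vs: "v \<in> supp i" using d_nonneg[of i v] v by (auto simp: supp_def)
      have "(\<Sum>w\<in>V - {v}. min (d i v) (d i w)) \<le> (\<Sum>w\<in>V - {v}. if w \<in> supp i then d i v else 0)"
        by (intro sum_mono) (auto simp: supp_def min_def not_less)
      also have "\<dots> = (\<Sum>w\<in>supp i - {v}. d i v)"
        using finite_V supp_subset[of i]
        by (subst sum.inter_restrict[symmetric]) (auto intro!: sum.cong simp del: sum_constant)
      also have "\<dots> = d i v * (int (card (supp i)) - 1)"
        using vs finite_supp[of i] card_gt_0_iff[of "supp i"]
        by (auto simp: card_Diff_singleton of_nat_diff Suc_le_eq)
      finally show ?thesis .
    qed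
  qed
  finally show ?thesis .
qed

section \<open>Distributing the loss over the vertices when all degrees exceed
  \<open>k\<close>\<close>

text \<open>
  The amount \<open>2 (e i - 1)\<close> lost by a colour is distributed over its vertices in proportion to their
  degrees; \<open>e i \<ge> |supp i| - 1\<close> is what makes the shares add up.
\<close>

definition share :: "'a \<Rightarrow> real" where
  "share v = (\<Sum>i\<in>T. real_of_int (d i v) * (1 - 1 / (real (card (supp i)) - 1)))"

text \<open>By \<open>handshake\<close>, colour \<open>i\<close> hands out
  \<open>2 * e i * (1 - 1 / z)\<close> with \<open>z = card (supp i) - 1\<close>, which is at most
  \<open>2 * e i - 2\<close> because \<open>z \<le> e i\<close>.\<close>

lemma sum_share_le: "(\<Sum>v\<in>V. share v) \<le> real_of_int (\<Sum>i\<in>T. 2 * e i - 2)"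
proof -
  have "(\<Sum>v\<in>V. share v) = (\<Sum>i\<in>T. \<Sum>v\<in>V. real_of_int (d i v) * (1 - 1 / (real (card (supp i)) - 1)))"
    unfolding share_def by (rule sum.swap)
  also have "\<dots> = (\<Sum>i\<in>T. real_of_int (\<Sum>v\<in>V. d i v) * (1 - 1 / (real (card (supp i)) - 1)))"
    by (simp add: sum_distrib_right)
  also have "\<dots> \<le> (\<Sum>i\<in>T. real_of_int (2 * e i - 2))"
  proof (intro sum_mono)
    fix i assume i: "i \<in> T"
    have "real (card (supp i)) \<ge> 3" "real (card (supp i)) \<le> real_of_int (e i) + 1"
      using card_supp_ge[OF i] card_supp_le_edges[OF i] by linarith+
    then show "real_of_int (\<Sum>v\<in>V. d i v) * (1 - 1 / (real (card (supp i)) - 1)) \<le> real_of_int (2 * e i - 2)"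
      unfolding handshake[OF i] by (simp add: field_simps)
  qed
  finally show ?thesis by simp
qed

lemma share_eq: "share v = real_of_int (deg v) - (\<Sum>i\<in>T. real_of_int (d i v) * (1 / (real (card (supp i)) - 1)))"
  unfolding share_def deg_def by (simp add: right_diff_distrib sum_subtractf)

text \<open>On the interval from 2 to \<open>m = n - 1\<close> the convex function
  \<open>1 / z\<close> lies below its chord \<open>1/2 + 1/m - z / (2 * m)\<close>. This makes the
  bound linear in the support sizes, whose weighted sum is controlled by
  \<open>sum_support_ge\<close>.\<close>

lemma share_ge:
  assumes v: "v \<in> V"
  shows "real_of_int (deg v) * (n - 2) / (2 * (n - 1)) + (k - 1) / 2 \<le> share v"
proof -
  define m :: real where "m = real (card V) - 1"
  have m: "m \<ge> 2" using card_V k_ge unfolding m_def by linarith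
  have "(\<Sum>i\<in>T. real_of_int (d i v) * (1 / (real (card (supp i)) - 1)))
      \<le> (\<Sum>i\<in>T. real_of_int (d i v) * (1/2 + 1/m - (real (card (supp i)) - 1) / (2 * m)))"
  proof (intro sum_mono mult_left_mono)
    fix i assume i: "i \<in> T"
    define z where "z = real (card (supp i)) - 1"
    have z: "2 \<le> z" "z \<le> m"
      using card_supp_ge[OF i] card_supp_le[of i] unfolding z_def m_def by linarith+
    then have "0 \<le> (z - 2) * (m - z) / (2 * m * z)" by simp
    also have "\<dots> = 1/2 + 1/m - z / (2 * m) - 1 / z" using z by (simp add: field_simps)
    finally show "1 / (real (card (supp i)) - 1) \<le> 1/2 + 1/m - (real (card (supp i)) - 1) / (2 * m)"
      unfolding z_def[symmetric] by simp
  qed (use d_nonneg in auto)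
  also have "\<dots> = (\<Sum>i\<in>T. real_of_int (d i v) * (1/2 + 1/m) - real_of_int (d i v * (int (card (supp i)) - 1)) / (2 * m))"
    by (intro sum.cong) (auto simp: right_diff_distrib)
  also have "\<dots> = real_of_int (deg v) * (1/2 + 1/m) - real_of_int (\<Sum>i\<in>T. d i v * (int (card (supp i)) - 1)) / (2 * m)"
    by (simp add: deg_def sum_subtractf sum_distrib_right sum_divide_distrib)
  also have "\<dots> \<le> real_of_int (deg v) * (1/2 + 1/m) - real_of_int ((k - 1) * (n - 1) + deg v) / (2 * m)"
    using of_int_le_iff[THEN iffD2, OF sum_support_ge[OF v]] m by (intro diff_left_mono divide_right_mono) auto
  also have "\<dots> = real_of_int (deg v) * (1/2 + 1/m) - ((k - 1) * m + deg v) / (2 * m)"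
    by (simp add: m_def)
  finally have "real_of_int (deg v) - (real_of_int (deg v) * (1/2 + 1/m) - ((k - 1) * m + deg v) / (2 * m)) \<le> share v"
    unfolding share_eq by linarith
  moreover have "real_of_int (deg v) - (real_of_int (deg v) * (1/2 + 1/m) - ((k - 1) * m + deg v) / (2 * m))
    = real_of_int (deg v) * (m - 1) / (2 * m) + (k - 1) / 2"
    using m by (simp add: field_simps)
  ultimately show ?thesis by (simp add: m_def)
qed

text \<open>
  For odd \<open>k n\<close> the chord bound \<open>share_ge\<close> just fails when \<open>k = 5\<close>. Here the integrality of the
  support sizes is used: at most one incident edge can lie in a three-vertex colour, and then none
  lies in a four-vertex colour.
\<close>

lemma share_gt_k5:
  assumes v: "v \<in> V" and k: "k = 5" and n7: "7 \<le> n" and dv: "6 \<le> deg v"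
  shows "5 - 3 / n < share v"
proof (cases "deg v = 6")
  case False
  define r :: real where "r = real (card V)"
  have r: "r \<ge> 7" using n7 by (simp add: r_def)
  have "7 * (r - 2) / (2 * (r - 1)) + 2 \<le> real_of_int (deg v) * (r - 2) / (2 * (r - 1)) + 2"
    using r False dv by (intro add_right_mono divide_right_mono mult_right_mono) auto
  then have "7 * (r - 2) / (2 * (r - 1)) + 2 \<le> share v"
    using share_ge[OF v] k by (simp add: r_def)
  moreover have "5 - 3 / r < 7 * (r - 2) / (2 * (r - 1)) + 2"
  proof -
    have "6 + r * 2 < r * r" using mult_right_mono[of 7 r r] r by linarith
    then show ?thesis using r by (simp add: field_simps)
  qed
  ultimately show ?thesis by (simp add: r_def)
next
  case True
  define z where "z i = int (card (supp i)) - 1" for i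
  \<comment> \<open>\<open>j\<close> and \<open>g\<close> count the edges at \<open>v\<close> in
    colours with three and four vertices respectively.\<close>
  define j where "j = (\<Sum>i\<in>T. d i v * of_bool (z i = 2))"
  define g where "g = (\<Sum>i\<in>T. d i v * of_bool (z i = 3))"
  define m :: real where "m = real (card V) - 1"
  have m: "m \<ge> 6" using n7 by (simp add: m_def)
  have z: "2 \<le> z i" "z i \<le> n - 1" if "i \<in> T" for i
    using card_supp_ge[OF that] card_supp_le[of i] unfolding z_def by linarith+
  have jg: "0 \<le> j" "0 \<le> g" unfolding j_def g_def by (auto intro!: sum_nonneg simp: d_nonneg)
  have sz: "4 * n + 2 \<le> (\<Sum>i\<in>T. d i v * z i)"
    using sum_support_ge[OF v] k True unfolding z_def by simp
  also have "\<dots> \<le> (\<Sum>i\<in>T. d i v * (n - 1) - (n - 3) * (d i v * of_bool (z i = 2)) - (n - 4) * (d i v * of_bool (z i = 3)))"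
  proof (intro sum_mono)
    fix i assume i: "i \<in> T"
    have "z i \<le> (n - 1) - (n - 3) * of_bool (z i = 2) - (n - 4) * of_bool (z i = 3)"
      using z[OF i] by (auto simp: of_bool_def)
    from mult_left_mono[OF this d_nonneg[of i v]]
    show "d i v * z i \<le> d i v * (n - 1) - (n - 3) * (d i v * of_bool (z i = 2)) - (n - 4) * (d i v * of_bool (z i = 3))"
      by (simp add: algebra_simps)
  qed
  also have "\<dots> = 6 * (n - 1) - (n - 3) * j - (n - 4) * g"
    using True by (simp add: sum_subtractf j_def g_def deg_def sum_distrib_left sum_distrib_right[symmetric])
  finally have bd: "(n - 3) * j + (n - 4) * g \<le> 2 * (n - 4)" by simp
  have "j + g \<le> 2 \<and> (j \<ge> 1 \<longrightarrow> j = 1 \<and> g = 0)"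
  proof -
    have "(n - 4) * (j + g) \<le> (n - 4) * 2"
      using bd jg by (simp add: algebra_simps)
    then have le2: "j + g \<le> 2" using n7 by (subst (asm) mult_le_cancel_left_pos) auto
    moreover have "j = 1 \<and> g = 0" if "j \<ge> 1"
    proof (rule ccontr)
      assume "\<not> (j = 1 \<and> g = 0)"
      then have "j + g = 2" using that jg le2 by auto
      then have "(n - 4) * j + (n - 4) * g = (n - 4) * 2" by (metis distrib_left)
      then show False using bd that by (simp add: algebra_simps)
    qed
    ultimately show ?thesis by blast
  qed
  then have jg_cases: "j = 0 \<and> g \<le> 2 \<or> j = 1 \<and> g = 0" using jg by auto
  \<comment> \<open>The chord now runs from \<open>z = 4\<close> to \<open>z = m\<close>; the last
    two terms are the exact corrections at \<open>z = 2\<close> and \<open>z = 3\<close>.\<close>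
  have "(\<Sum>i\<in>T. real_of_int (d i v) * (1 / (real (card (supp i)) - 1)))
      \<le> (\<Sum>i\<in>T. real_of_int (d i v) * (1/4 + 1/m - z i / (4 * m)
          + (1/4 - 1/(2*m)) * of_bool (z i = 2) + (1/12 - 1/(4*m)) * of_bool (z i = 3)))"
  proof (intro sum_mono mult_left_mono)
    fix i assume i: "i \<in> T"
    have zr: "real (card (supp i)) - 1 = real_of_int (z i)" by (simp add: z_def)
    have zm: "real_of_int (z i) \<le> m" using z(2)[OF i] unfolding m_def by linarith
    consider "z i = 2" | "z i = 3" | "4 \<le> z i" using z(1)[OF i] by linarith
    then show "1 / (real (card (supp i)) - 1) \<le> 1/4 + 1/m - z i / (4 * m)
          + (1/4 - 1/(2*m)) * of_bool (z i = 2) + (1/12 - 1/(4*m)) * of_bool (z i = 3)"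
    proof cases
      case 3
      define y where "y = real_of_int (z i)"
      have y: "4 \<le> y" "y \<le> m" using 3 zm by (auto simp: y_def)
      then have "0 \<le> (y - 4) * (m - y) / (4 * m * y)" by simp
      also have "\<dots> = 1/4 + 1/m - y / (4 * m) - 1 / y" using y by (simp add: field_simps)
      finally have "1 / y \<le> 1/4 + 1/m - y / (4 * m)" by simp
      then show ?thesis unfolding zr using 3 by (simp add: y_def)
    qed (use m in \<open>auto simp: zr field_simps\<close>)
  qed (use d_nonneg in auto)
  also have "\<dots> = (\<Sum>i\<in>T. real_of_int (d i v) * (1/4 + 1/m) - real_of_int (d i v * z i) / (4 * m)
      + real_of_int (d i v * of_bool (z i = 2)) * (1/4 - 1/(2*m)) + real_of_int (d i v * of_bool (z i = 3)) * (1/12 - 1/(4*m)))"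
    by (intro sum.cong) (auto simp: algebra_simps)
  also have "\<dots> = real_of_int (deg v) * (1/4 + 1/m) - real_of_int (\<Sum>i\<in>T. d i v * z i) / (4 * m)
      + j * (1/4 - 1/(2*m)) + g * (1/12 - 1/(4*m))"
    unfolding j_def g_def deg_def of_int_sum sum_distrib_right sum_divide_distrib
    by (simp only: sum_subtractf sum.distrib)
  also have "\<dots> \<le> 6 * (1/4 + 1/m) - (4 * m + 6) / (4 * m) + (1/4 - 1/(2*m))"
  proof -
    have "4 * m + 6 \<le> real_of_int (\<Sum>i\<in>T. d i v * z i)"
      using of_int_le_iff[where 'a = real, THEN iffD2, OF sz] by (simp add: m_def)
    then have "(4 * m + 6) / (4 * m) \<le> real_of_int (\<Sum>i\<in>T. d i v * z i) / (4 * m)"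
      using m by (intro divide_right_mono) auto
    moreover have "j * (1/4 - 1/(2*m)) + g * (1/12 - 1/(4*m)) \<le> 1/4 - 1/(2*m)"
      using jg_cases
    proof
      assume a: "j = 0 \<and> g \<le> 2"
      have "g * (1/12 - 1/(4*m)) \<le> 2 * (1/12 - 1/(4*m))"
        using a m by (intro mult_right_mono) (auto simp: field_simps)
      then show ?thesis using a by simp
    qed simp
    ultimately show ?thesis using True by simp
  qed
  also have "\<dots> = 3/4 + 4/m" using m by (simp add: field_simps)
  also have "\<dots> < 1 + 3 / (m + 1)"
  proof -
    have "m * 3 + 16 < m * m" using mult_right_mono[of 6 m m] m by linarith
    then show ?thesis using m by (simp add: field_simps)
  qed
  finally show ?thesis unfolding share_eq using True by (simp add: m_def)
qed

text \<open>Summing the shares gives a lower bound \<open>k n - (k + 1) n / (2 (n - 1))\<close>,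
  which exceeds \<open>k n - 4\<close>. Since the sum is even, this suffices for even
  \<open>k n\<close>. For odd \<open>k n\<close> the sum has to exceed \<open>k n - 3\<close>: this
  is immediate for \<open>k = 3\<close> and follows from \<open>share_gt_k5\<close> for
  \<open>k = 5\<close>, where \<open>n\<close> is odd and hence at least 7.\<close>

lemma no_tight:
  assumes nt: "\<And>v. v \<in> V \<Longrightarrow> k + 1 \<le> deg v" and k5: "k \<le> 5"
  shows "k * n - 2 \<le> (\<Sum>i\<in>T. 2 * e i - 2)"
proof -
  define S where "S = (\<Sum>i\<in>T. 2 * e i - 2)"
  define r :: real where "r = real (card V)"
  have r: "r \<ge> k + 1" "r \<ge> 3" using card_V k_ge unfolding r_def by linarith+
  have S: "(\<Sum>v\<in>V. share v) \<le> real_of_int S" using sum_share_le by (simp add: S_def)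
  have evS: "even S" unfolding S_def by (rule dvd_sum) auto
  have "(\<Sum>v\<in>V. (k + 1) * (r - 2) / (2 * (r - 1)) + (k - 1) / 2) \<le> (\<Sum>v\<in>V. share v)"
  proof (intro sum_mono)
    fix v assume v: "v \<in> V"
    have "(k + 1) * (r - 2) / (2 * (r - 1)) \<le> deg v * (r - 2) / (2 * (r - 1))"
      using nt[OF v] r by (intro divide_right_mono mult_right_mono) auto
    then show "(k + 1) * (r - 2) / (2 * (r - 1)) + (k - 1) / 2 \<le> share v"
      using share_ge[OF v] by (simp add: r_def)
  qed
  then have "r * ((k + 1) * (r - 2) / (2 * (r - 1)) + (k - 1) / 2) \<le> S"
    using S by (simp add: r_def)
  moreover have "r * ((k + 1) * (r - 2) / (2 * (r - 1)) + (k - 1) / 2) = k * r - (k + 1) * r / (2 * (r - 1))"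
    using r by (simp add: field_simps)
  ultimately have main: "k * r - (k + 1) * r / (2 * (r - 1)) \<le> S" by simp
  have kc: "k = 2 \<or> k = 3 \<or> k = 4 \<or> k = 5" using k_ge k5 by auto
  show ?thesis
  proof (cases "even (k * n)")
    case True
    have "(k + 1) * r / (2 * (r - 1)) < 4" using kc r by (auto simp: field_simps)
    then have "k * r - 4 < S" using main by linarith
    then have "real_of_int (k * n - 4) < real_of_int S" by (simp add: r_def)
    then have "k * n - 4 < S" by linarith
    moreover have "k * n - 3 \<noteq> S" using True evS by fastforce
    ultimately show ?thesis unfolding S_def[symmetric] by linarith
  next
    case False
    then have k35: "k = 3 \<or> k = 5" and on: "odd n" using kc by auto
    have "k * r - 3 < S"
    proof (cases "k = 3")
      case True
      then have "(k + 1) * r / (2 * (r - 1)) < 3" using r by (auto simp: field_simps)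
      then show ?thesis using main by linarith
    next
      case False
      then have k: "k = 5" using k35 by simp
      have n7: "7 \<le> n" using card_V on k by presburger
      have "(\<Sum>v\<in>V. 5 - 3 / r) < (\<Sum>v\<in>V. share v)"
        using share_gt_k5[OF _ k n7] nt k n7 finite_V unfolding r_def by (intro sum_strict_mono) auto
      then show ?thesis using S k r by (simp add: r_def right_diff_distrib)
    qed
    then have "real_of_int (k * n - 3) < real_of_int S" by (simp add: r_def)
    then show ?thesis unfolding S_def[symmetric] by linarith
  qed
qed

section \<open>Degree vectors compared with that of a tight vertex\<close>

text \<open>
  A vertex \<open>u\<close> is tight if \<open>deg u = k\<close>. By \<open>pair\<close>, any other vertex falls short of the degree vector
  of a tight vertex by at most one in total, and a neighbour of \<open>u\<close> does not fall short at all.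
\<close>

definition deficient :: "'a \<Rightarrow> 'i \<Rightarrow> 'a set" where
  "deficient u i = {v \<in> V. d i v < d i u}"

definition colours_at :: "'a \<Rightarrow> 'i set" where
  "colours_at u = {i \<in> T. 0 < d i u}"

definition outer_deg :: "'a \<Rightarrow> 'a \<Rightarrow> int" where
  "outer_deg u v = (\<Sum>i\<in>T - colours_at u. d i v)"

text \<open>
  Colours missing at \<open>u\<close> compensate deficient vertices; \<open>pay\<close> is twice the compensation received
  by \<open>v\<close>.
\<close>

definition pay :: "'a \<Rightarrow> 'a \<Rightarrow> int" where
  "pay u v = (\<Sum>i\<in>T - colours_at u. if 4 \<le> card (supp i) then 2 * of_bool (0 < d i v) else d i v)"

lemma colours_at_subset: "colours_at u \<subseteq> T" by (auto simp: colours_at_def)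

lemma finite_colours_at: "finite (colours_at u)"
  using finite_subset[OF colours_at_subset finite_T] .

lemma deficient_subset: "deficient u i \<subseteq> V" by (auto simp: deficient_def)

lemma finite_deficient: "finite (deficient u i)"
  using finite_subset[OF deficient_subset finite_V] .

lemma deg_split: "deg v = (\<Sum>i\<in>colours_at u. d i v) + outer_deg u v"
  unfolding deg_def outer_deg_def using sum.subset_diff[OF colours_at_subset finite_T] by (metis add.commute)

lemma sum_edges_split: "(\<Sum>i\<in>T. 2 * e i - 2) = (\<Sum>i\<in>colours_at u. 2 * e i - 2) + (\<Sum>i\<in>T - colours_at u. 2 * e i - 2)"
  using sum.subset_diff[OF colours_at_subset finite_T] by (metis add.commute)

lemma outer_edges_nonneg: "0 \<le> (\<Sum>i\<in>T - colours_at u. 2 * e i - 2)"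
  using edges_ge by (intro sum_nonneg) force

lemma outer_edges_ge: assumes "T \<noteq> colours_at u" shows "2 \<le> (\<Sum>i\<in>T - colours_at u. 2 * e i - 2)"
proof -
  obtain i where i: "i \<in> T - colours_at u" using assms colours_at_subset by blast
  have "2 * e i - 2 \<le> (\<Sum>i\<in>T - colours_at u. 2 * e i - 2)"
    using edges_ge finite_T by (intro member_le_sum[OF i]) force+
  then show ?thesis using edges_ge i by force
qed

lemma outer_deg_nonneg: "0 \<le> outer_deg u v"
  unfolding outer_deg_def using d_nonneg by (simp add: sum_nonneg)

text \<open>\<open>pay\<close> is calibrated for this bound: a colour with at least four vertices
  pays \<open>2 * card (supp i) \<le> 2 * e i + 2\<close>, and \<open>e i \<ge> 3\<close>; a
  three-vertex colour pays its degree sum \<open>2 * e i\<close>, and \<open>e i \<ge> 2\<close>.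
  Both are at most \<open>4 * e i - 4\<close>.\<close>

lemma sum_pay_le: "(\<Sum>v\<in>V. pay u v) \<le> 2 * (\<Sum>i\<in>T - colours_at u. 2 * e i - 2)"
proof -
  have "(\<Sum>v\<in>V. pay u v) = (\<Sum>i\<in>T - colours_at u. \<Sum>v\<in>V. if 4 \<le> card (supp i) then 2 * of_bool (0 < d i v) else d i v)"
    unfolding pay_def by (rule sum.swap)
  also have "\<dots> \<le> (\<Sum>i\<in>T - colours_at u. 2 * (2 * e i - 2))"
  proof (intro sum_mono)
    fix i assume "i \<in> T - colours_at u"
    then have i: "i \<in> T" by simp
    show "(\<Sum>v\<in>V. if 4 \<le> card (supp i) then 2 * of_bool (0 < d i v) else d i v) \<le> 2 * (2 * e i - 2)"
    proof (cases "4 \<le> card (supp i)")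
      case True
      have "(\<Sum>v\<in>V. of_bool (0 < d i v)) = int (card (supp i))"
        using finite_V by (simp add: supp_def Int_def)
      then show ?thesis using True card_supp_le_edges[OF i] by (simp add: sum_distrib_left[symmetric])
    next
      case False
      then show ?thesis using handshake[OF i] edges_ge[OF i] by simp
    qed
  qed
  finally show ?thesis by (simp add: sum_distrib_left)
qed

lemma pay_ge_2:
  assumes "i \<in> T - colours_at u" "4 \<le> card (supp i)" "0 < d i v"
  shows "2 \<le> pay u v"
proof -
  have "(if 4 \<le> card (supp i) then 2 * of_bool (0 < d i v) else d i v) \<le> pay u v"
    unfolding pay_def using finite_T d_nonneg by (intro member_le_sum[OF assms(1)]) auto
  then show ?thesis using assms by simp
qed

lemma pay_ge_min: "min 2 (outer_deg u v) \<le> pay u v"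
proof (cases "\<exists>i\<in>T - colours_at u. 4 \<le> card (supp i) \<and> 0 < d i v")
  case True
  then have "2 \<le> pay u v" using pay_ge_2 by blast
  then show ?thesis by simp
next
  case False
  have "outer_deg u v \<le> pay u v"
    unfolding pay_def outer_deg_def using False d_nonneg by (intro sum_mono) (auto simp: not_less)
  then show ?thesis by simp
qed

lemma pay_nonneg: "0 \<le> pay u v"
  using pay_ge_min[of u v] outer_deg_nonneg[of u v] by linarith

context
  fixes u
  assumes u: "u \<in> V" and tight: "deg u = k"
begin

lemma sum_deficit:
  assumes v: "v \<in> V"
  shows "(\<Sum>i\<in>T. if v \<in> deficient u i then d i u - d i v else 0) \<le> (if v = u \<or> N u v then 0 else 1)"
proof -
  have "(\<Sum>i\<in>T. if v \<in> deficient u i then d i u - d i v else 0) = (\<Sum>i\<in>T. d i u - min (d i u) (d i v))"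
    using v by (intro sum.cong) (auto simp: deficient_def min_def)
  also have "\<dots> = k - (\<Sum>i\<in>T. min (d i u) (d i v))"
    using tight by (simp add: sum_subtractf deg_def)
  also have "\<dots> \<le> (if v = u \<or> N u v then 0 else 1)"
    using pair[OF u v] adjacent[OF u v] tight by (auto simp: deg_def)
  finally show ?thesis .
qed

lemma
  assumes i: "i \<in> T" and v: "v \<in> deficient u i"
  shows deficient_value: "d i v = d i u - 1"
    and deficient_not_adjacent: "v \<noteq> u" "\<not> N u v"
proof -
  have vV: "v \<in> V" using v by (simp add: deficient_def)
  have "(if v \<in> deficient u i then d i u - d i v else 0) \<le> (\<Sum>i\<in>T. if v \<in> deficient u i then d i u - d i v else 0)"
    using finite_T by (intro member_le_sum[OF i]) (auto simp: deficient_def)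
  then have "d i u - d i v \<le> (if v = u \<or> N u v then 0 else 1)"
    using sum_deficit[OF vV] v by auto
  moreover have "d i v < d i u" using v by (simp add: deficient_def)
  ultimately show "d i v = d i u - 1" "v \<noteq> u" "\<not> N u v" by (auto split: if_splits)
qed

lemma deficient_unique:
  assumes "i \<in> T" "j \<in> T" "v \<in> deficient u i" "v \<in> deficient u j"
  shows "i = j"
proof (rule ccontr)
  assume "i \<noteq> j"
  have vV: "v \<in> V" using assms by (simp add: deficient_def)
  have "(\<Sum>l\<in>{i, j}. if v \<in> deficient u l then d l u - d l v else 0)
      \<le> (\<Sum>l\<in>T. if v \<in> deficient u l then d l u - d l v else 0)"
    using finite_T assms by (intro sum_mono2) (auto simp: deficient_def)
  also have "\<dots> \<le> 1" using sum_deficit[OF vV] by (auto split: if_splits)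
  finally show False
    using \<open>i \<noteq> j\<close> assms deficient_value[of i v] deficient_value[of j v] by simp
qed

text \<open>The sets \<open>deficient u i\<close> are pairwise disjoint and avoid \<open>u\<close>
  and its \<open>k\<close> neighbours.\<close>

lemma sum_card_deficient:
  assumes "I \<subseteq> T"
  shows "(\<Sum>i\<in>I. int (card (deficient u i))) \<le> n - 1 - k"
proof -
  have fI: "finite I" using finite_subset[OF assms finite_T] .
  have "(\<Sum>i\<in>I. card (deficient u i)) = card (\<Union>i\<in>I. deficient u i)"
    using deficient_unique assms fI by (subst card_UN_disjoint) (auto simp: finite_deficient)
  also have "\<dots> \<le> card (V - insert u {v \<in> V. N u v})"
    using deficient_not_adjacent assms deficient_subset finite_V by (intro card_mono) blast+
  also have "\<dots> = card V - card (insert u {v \<in> V. N u v})"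
    using u finite_V by (intro card_Diff_subset) auto
  finally have "(\<Sum>i\<in>I. card (deficient u i)) \<le> card V - card (insert u {v \<in> V. N u v})" .
  moreover have "card (insert u {v \<in> V. N u v}) = card {v \<in> V. N u v} + 1"
    using adjacent[OF u u] finite_V by (subst card_insert_disjoint) auto
  moreover have "int (card {v \<in> V. N u v}) = k" using neighbours[OF u] tight by (simp add: deg_def)
  ultimately have "int (\<Sum>i\<in>I. card (deficient u i)) \<le> n - 1 - k"
    using card_V by linarith
  then show ?thesis by simp
qed

lemma card_supp_ge_deficient:
  assumes i: "i \<in> colours_at u"
  shows "n - int (card (deficient u i)) \<le> int (card (supp i))"
proof -
  have "V \<subseteq> supp i \<union> deficient u i"
    using i by (auto simp: supp_def deficient_def colours_at_def)
  then have "card V \<le> card (supp i \<union> deficient u i)"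
    using finite_supp finite_deficient by (intro card_mono) auto
  also have "\<dots> \<le> card (supp i) + card (deficient u i)" by (rule card_Un_le)
  finally show ?thesis by linarith
qed

lemma tight_card_supp:
  assumes i: "i \<in> colours_at u"
  shows "k + 1 \<le> int (card (supp i))"
  using card_supp_ge_deficient[OF i] sum_card_deficient[of "{i}"] i by (auto simp: colours_at_def)

lemma tight_edges:
  assumes i: "i \<in> T"
  shows "d i u * n - int (card (deficient u i)) \<le> 2 * e i"
proof -
  have "d i u * n - int (card (deficient u i)) = (\<Sum>v\<in>V. d i u - of_bool (v \<in> deficient u i))"
    using finite_V deficient_subset[of u i] by (simp add: sum_subtractf Int_absorb1 mult.commute)
  also have "\<dots> \<le> (\<Sum>v\<in>V. d i v)"
    using deficient_value[OF i] by (intro sum_mono) (auto simp: deficient_def of_bool_def)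
  finally show ?thesis using handshake[OF i] by simp
qed

text \<open>A connected class has at least \<open>card (supp i) - 1\<close> edges; this beats
  \<open>tight_edges\<close> when \<open>d i u = 1\<close>.\<close>

lemma tight_edges_tree:
  assumes i: "i \<in> colours_at u"
  shows "2 * (n - int (card (deficient u i))) - 2 \<le> 2 * e i"
  using card_supp_ge_deficient[OF i] card_supp_le_edges[of i] i colours_at_subset[of u] by force

lemma sum_d_tight: "(\<Sum>i\<in>colours_at u. d i u) = k"
  unfolding tight[symmetric] deg_def using finite_T colours_at_subset d_nonneg
  by (intro sum.mono_neutral_left) (auto simp: colours_at_def less_le)

lemma card_colours_at_le: "int (card (colours_at u)) \<le> k"
proof -
  have "(\<Sum>i\<in>colours_at u. 1) \<le> (\<Sum>i\<in>colours_at u. d i u)"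
    by (intro sum_mono) (auto simp: colours_at_def)
  then show ?thesis using sum_d_tight by simp
qed

text \<open>All colours at \<open>u\<close> are nearly spanning. The tree bound for each of them
  gives at least \<open>(k + 2) * (n - 2)\<close>, less twice the at most \<open>n - 1 - k\<close>
  deficient vertices, and this equals \<open>k * n - 2\<close>.\<close>

lemma many_colours:
  assumes s: "k + 2 \<le> 2 * int (card (colours_at u))"
  shows "k * n - 2 \<le> (\<Sum>i\<in>T. 2 * e i - 2)"
proof -
  define s' where "s' = int (card (colours_at u))"
  have "(\<Sum>i\<in>colours_at u. 2 * (n - int (card (deficient u i))) - 4) \<le> (\<Sum>i\<in>colours_at u. 2 * e i - 2)"
    using tight_edges_tree by (intro sum_mono) force
  moreover have "(\<Sum>i\<in>colours_at u. 2 * (n - int (card (deficient u i))) - 4)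
      = 2 * s' * (n - 2) - 2 * (\<Sum>i\<in>colours_at u. int (card (deficient u i)))"
    by (simp add: sum_subtractf sum.distrib s'_def algebra_simps sum_distrib_left)
  moreover have "(k + 2) * (n - 2) \<le> 2 * s' * (n - 2)"
    using s card_V k_ge unfolding s'_def by (intro mult_right_mono) auto
  ultimately show ?thesis
    using sum_card_deficient[OF colours_at_subset[of u]] sum_edges_split[of u] outer_edges_nonneg[of u]
    by (simp add: algebra_simps)
qed

definition "singles = {i \<in> colours_at u. d i u = 1}"

lemma singles_subset: "singles \<subseteq> colours_at u" by (auto simp: singles_def)

text \<open>\<open>tight_edges\<close> yields \<open>k * n\<close> up to deficient vertices, and
  each colour of degree one at \<open>u\<close> gains a further \<open>n - 2\<close>, less its own
  deficient vertices, from the tree bound. Two such gains cover, up to the allowed 2, the deficient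
  vertices counted twice and the loss of 2 for each of at most \<open>k\<close> colours.\<close>

lemma two_singles:
  assumes q: "2 \<le> card singles"
  shows "k * n - 2 \<le> (\<Sum>i\<in>T. 2 * e i - 2)"
proof -
  let ?J = "colours_at u" and ?D = "\<lambda>i. int (card (deficient u i))"
  have "(\<Sum>i\<in>?J. d i u * n - ?D i + of_bool (d i u = 1) * (n - ?D i - 2) - 2) \<le> (\<Sum>i\<in>?J. 2 * e i - 2)"
  proof (intro sum_mono)
    fix i assume i: "i \<in> ?J"
    show "d i u * n - ?D i + of_bool (d i u = 1) * (n - ?D i - 2) - 2 \<le> 2 * e i - 2"
      using tight_edges_tree[OF i] tight_edges[of i] i colours_at_subset[of u] by auto
  qed
  moreover have "(\<Sum>i\<in>?J. d i u * n - ?D i + of_bool (d i u = 1) * (n - ?D i - 2) - 2)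
      = (\<Sum>i\<in>?J. d i u) * n - (\<Sum>i\<in>?J. ?D i) + (\<Sum>i\<in>?J. of_bool (d i u = 1) * (n - ?D i - 2)) - 2 * int (card ?J)"
    by (simp add: sum.distrib sum_subtractf sum_distrib_right)
  moreover have "(\<Sum>i\<in>?J. of_bool (d i u = 1) * (n - ?D i - 2)) = (\<Sum>i\<in>singles. n - ?D i - 2)"
    unfolding singles_def sum.inter_filter[OF finite_colours_at] by (intro sum.cong) auto
  moreover have "(\<Sum>i\<in>singles. n - ?D i - 2) = int (card singles) * (n - 2) - (\<Sum>i\<in>singles. ?D i)"
    by (simp add: sum_subtractf right_diff_distrib)
  moreover have "2 * (n - 2) \<le> int (card singles) * (n - 2)"
    using q card_V k_ge by (intro mult_right_mono) auto
  moreover have "(\<Sum>i\<in>?J. ?D i) \<le> n - 1 - k" "(\<Sum>i\<in>singles. ?D i) \<le> n - 1 - k"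
    using sum_card_deficient colours_at_subset singles_subset by (meson subset_trans)+
  ultimately show ?thesis
    using sum_d_tight card_colours_at_le sum_edges_split[of u] outer_edges_nonneg[of u]
    by (simp add: algebra_simps)
qed

end

text \<open>Every colour at the tight vertex \<open>v\<close> has at least
  \<open>k + 1 \<ge> 4\<close> vertices, so a single outer edge already earns the full payment of
  2.\<close>

lemma pay_tight:
  assumes "v \<in> V" "deg v = k" "3 \<le> k" "0 < outer_deg u v"
  shows "2 \<le> pay u v"
proof -
  obtain i where i: "i \<in> T - colours_at u" "0 < d i v"
    using assms(4) d_nonneg unfolding outer_deg_def by (metis less_le sum.neutral)
  then have "k + 1 \<le> int (card (supp i))"
    using assms by (intro tight_card_supp[of v]) (auto simp: colours_at_def)
  then show ?thesis using i assms by (intro pay_ge_2[of i]) auto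
qed

text \<open>The colour \<open>j\<close> of degree one is counted by the tree bound, which charges 2
  for each vertex missing \<open>j\<close>. Such a vertex still has degree at least
  \<open>k\<close>, so it returns one unit through surplus degree in the other colours at
  \<open>u\<close> or through colours missing at \<open>u\<close>.\<close>

lemma one_single:
  assumes u: "u \<in> V" and tight: "deg u = k" and q: "card (singles u) = 1"
    and s: "2 * int (card (colours_at u)) \<le> k + 1" and k3: "3 \<le> k"
  shows "k * n - 2 \<le> (\<Sum>i\<in>T. 2 * e i - 2)"
proof -
  let ?J = "colours_at u" and ?D = "\<lambda>i. int (card (deficient u i))"
  obtain j where j: "singles u = {j}" using q card_1_singletonE by blast
  define B where "B = ?J - {j}"
  have jJ: "j \<in> ?J" "d j u = 1" using j singles_def[OF u tight] by auto
  then have jT: "j \<in> T" using colours_at_subset by auto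
  have BT: "B \<subseteq> T" unfolding B_def using colours_at_subset by auto
  have split: "(\<Sum>i\<in>?J. f i) = f j + (\<Sum>i\<in>B. f i)" for f :: "'i \<Rightarrow> int"
    unfolding B_def using sum.remove[OF finite_colours_at jJ(1)] .
  have kB: "(\<Sum>i\<in>B. d i u) = k - 1" using split[of "\<lambda>i. d i u"] sum_d_tight[OF u tight] jJ by simp
  have ge: "- of_bool (v \<in> deficient u i) \<le> d i v - d i u" if "v \<in> V" "i \<in> B" for v i
    using deficient_value[OF u tight, of i v] that BT by (auto simp: of_bool_def deficient_def)
  have bal: "2 * of_bool (v \<in> deficient u j) - 2 * (\<Sum>i\<in>B. of_bool (v \<in> deficient u i))
      \<le> 2 * (\<Sum>i\<in>B. d i v - d i u) + pay u v" if v: "v \<in> V" for v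
  proof -
    have "(\<Sum>i\<in>B. - of_bool (v \<in> deficient u i)) \<le> (\<Sum>i\<in>B. d i v - d i u)"
      using ge[OF v] by (rule sum_mono)
    then have 1: "- (\<Sum>i\<in>B. of_bool (v \<in> deficient u i)) \<le> (\<Sum>i\<in>B. d i v - d i u)"
      by (simp add: sum_negf del: sum_of_bool_eq)
    show ?thesis
    proof (cases "v \<in> deficient u j")
      case False
      then show ?thesis using 1 pay_nonneg[of u v] by (simp del: sum_of_bool_eq)
    next
      case True
      have "v \<notin> deficient u i" if "i \<in> B" for i
        using deficient_unique[OF u tight, of i j v] that BT jT True by (auto simp: B_def)
      then have 2: "(\<Sum>i\<in>B. of_bool (v \<in> deficient u i)) = (0::int)" by (intro sum.neutral) auto
      have "d j v = 0" using deficient_value[OF u tight jT True] jJ by simp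
      then have "deg v = (\<Sum>i\<in>B. d i v - d i u) + (k - 1) + outer_deg u v"
        using deg_split[of v u] split[of "\<lambda>i. d i v"] kB by (simp add: sum_subtractf)
      \<comment> \<open>Without surplus in \<open>B\<close>, the missing edge must be an outer one;
        if there is only one outer edge, then \<open>deg v = k\<close> and \<open>pay_tight\<close>
        applies.\<close>
      then have "2 \<le> 2 * (\<Sum>i\<in>B. d i v - d i u) + pay u v"
        using deg_ge[OF v] 1 2 pay_ge_min[of u v] pay_tight[OF v _ k3, of u] pay_nonneg[of u v]
        by (cases "(\<Sum>i\<in>B. d i v - d i u) = 0"; cases "outer_deg u v = 1") auto
      then show ?thesis using 2 True by (simp del: sum_of_bool_eq)
    qed
  qed
  have halve: "a - b + c \<le> x + w" if "2 * a - 2 * b \<le> 2 * (x - c) + p" "p \<le> 2 * w" for a b c x w p :: int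
    using that by presburger
  have card_eq: "(\<Sum>v\<in>V. of_bool (v \<in> deficient u i)) = ?D i" for i
    using finite_V deficient_subset[of u i] by (simp add: Int_absorb1)
  have "2 * ?D j - 2 * (\<Sum>i\<in>B. ?D i)
      = (\<Sum>v\<in>V. 2 * of_bool (v \<in> deficient u j) - 2 * (\<Sum>i\<in>B. of_bool (v \<in> deficient u i)))"
    unfolding sum_subtractf sum_distrib_left[symmetric] card_eq
    by (subst sum.swap) (simp only: card_eq)
  also have "\<dots> \<le> (\<Sum>v\<in>V. 2 * (\<Sum>i\<in>B. d i v - d i u) + pay u v)"
    using bal by (rule sum_mono)
  also have "\<dots> = 2 * (\<Sum>i\<in>B. \<Sum>v\<in>V. d i v - d i u) + (\<Sum>v\<in>V. pay u v)"
    unfolding sum.distrib sum_distrib_left[symmetric] by (subst sum.swap) simp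
  also have "(\<Sum>i\<in>B. \<Sum>v\<in>V. d i v - d i u) = (\<Sum>i\<in>B. 2 * e i - n * d i u)"
    using handshake BT by (intro sum.cong) (auto simp: sum_subtractf)
  also have "\<dots> = (\<Sum>i\<in>B. 2 * e i) - n * (k - 1)"
    unfolding sum_subtractf sum_distrib_left[symmetric] kB ..
  finally have "?D j - (\<Sum>i\<in>B. ?D i) + n * (k - 1) \<le> (\<Sum>i\<in>B. 2 * e i) + (\<Sum>i\<in>T - ?J. 2 * e i - 2)"
    using sum_pay_le[of u] halve by blast
  moreover have "?D j + (\<Sum>i\<in>B. ?D i) \<le> n - 1 - k"
    using sum_card_deficient[OF u tight colours_at_subset[of u]] split[of ?D] by simp
  moreover have "2 * (n - ?D j) - 2 \<le> 2 * e j" using tight_edges_tree[OF u tight jJ(1)] .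
  moreover have "(\<Sum>i\<in>?J. 2 * e i - 2) = 2 * e j + (\<Sum>i\<in>B. 2 * e i) - 2 * int (card ?J)"
    using split[of "\<lambda>i. 2 * e i"] by (simp add: sum_subtractf)
  ultimately show ?thesis using s sum_edges_split[of u] by (simp add: algebra_simps)
qed

text \<open>Each vertex contributes twice its surplus over \<open>u\<close> in the colours at
  \<open>u\<close>, plus \<open>pay\<close>. A surplus of -1 is repaid by outer colours because
  \<open>deg v \<ge> k\<close>, and a nowhere deficient vertex of degree above \<open>k\<close>
  leaves at least 1 over. The count of these vertices later serves as the size of a
  separator.\<close>

lemma no_single:
  assumes u: "u \<in> V" and tight: "deg u = k" and k3: "3 \<le> k"
  shows "int (card {v \<in> V. (\<forall>i\<in>T. v \<notin> deficient u i) \<and> k < deg v})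
    \<le> 2 * ((\<Sum>i\<in>colours_at u. 2 * e i) + (\<Sum>i\<in>T - colours_at u. 2 * e i - 2) - k * n)"
proof -
  let ?J = "colours_at u" and ?R = "{v \<in> V. (\<forall>i\<in>T. v \<notin> deficient u i) \<and> k < deg v}"
  have bal: "of_bool (v \<in> ?R) \<le> 2 * (\<Sum>i\<in>?J. d i v - d i u) + pay u v" if v: "v \<in> V" for v
  proof -
    define X where "X = (\<Sum>i\<in>?J. d i v - d i u)"
    have dv: "deg v = X + k + outer_deg u v"
      unfolding X_def using deg_split[of v u] sum_d_tight[OF u tight] by (simp add: sum_subtractf)
    have "(\<Sum>i\<in>?J. if v \<in> deficient u i then d i u - d i v else 0)
        \<le> (\<Sum>i\<in>T. if v \<in> deficient u i then d i u - d i v else 0)"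
      using finite_T colours_at_subset by (intro sum_mono2) (auto simp: deficient_def)
    also have "\<dots> \<le> 1" using sum_deficit[OF u tight v] by (auto split: if_splits)
    finally have "(\<Sum>i\<in>?J. if v \<in> deficient u i then d i u - d i v else 0) \<le> 1" .
    moreover have "(\<Sum>i\<in>?J. d i u - d i v) \<le> (\<Sum>i\<in>?J. if v \<in> deficient u i then d i u - d i v else 0)"
      using v by (intro sum_mono) (auto simp: deficient_def)
    ultimately have X: "- 1 \<le> X" unfolding X_def by (simp add: sum_subtractf)
    have X0: "0 \<le> X" if "v \<in> ?R"
      unfolding X_def using that colours_at_subset v by (intro sum_nonneg) (fastforce simp: deficient_def)
    show ?thesis
    proof (cases "v \<in> ?R")
      case True
      then have "1 \<le> X + outer_deg u v" using dv by simp
      then have "1 \<le> 2 * X + pay u v"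
        using X0[OF True] pay_ge_min[of u v] pay_nonneg[of u v] by (cases "X = 0") auto
      then show ?thesis using True by (simp add: X_def)
    next
      case False
      have "0 \<le> 2 * X + pay u v"
        using dv deg_ge[OF v] X pay_ge_min[of u v] pay_tight[OF v _ k3, of u] pay_nonneg[of u v]
        by (cases "X = - 1"; cases "outer_deg u v = 1") auto
      then show ?thesis using False unfolding X_def of_bool_def by (simp only: if_False)
    qed
  qed
  have "int (card ?R) = (\<Sum>v\<in>V. of_bool (v \<in> ?R))"
    using finite_V by (simp add: Int_def)
  also have "\<dots> \<le> (\<Sum>v\<in>V. 2 * (\<Sum>i\<in>?J. d i v - d i u) + pay u v)"
    using bal by (rule sum_mono)
  also have "\<dots> = 2 * (\<Sum>i\<in>?J. \<Sum>v\<in>V. d i v - d i u) + (\<Sum>v\<in>V. pay u v)"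
    unfolding sum.distrib sum_distrib_left[symmetric] by (subst sum.swap) simp
  also have "(\<Sum>i\<in>?J. \<Sum>v\<in>V. d i v - d i u) = (\<Sum>i\<in>?J. 2 * e i - n * d i u)"
    using handshake colours_at_subset by (intro sum.cong) (auto simp: sum_subtractf)
  also have "\<dots> = (\<Sum>i\<in>?J. 2 * e i) - n * k"
    unfolding sum_subtractf sum_distrib_left[symmetric] sum_d_tight[OF u tight] ..
  finally show ?thesis using sum_pay_le[of u] by (simp add: algebra_simps)
qed

end

section \<open>Two colours at a tight vertex, and the final case distinction\<close>

locale separated_degree_system = degree_system +
  assumes separator: "\<lbrakk>A \<subseteq> V; R \<subseteq> V; A \<inter> R = {}; u \<in> A; v \<in> V - A - R;
      \<And>x y. \<lbrakk>x \<in> A; y \<in> V; N x y\<rbrakk> \<Longrightarrow> y \<in> A \<union> R\<rbrakk> \<Longrightarrow> k - 1 \<le> int (card R)"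
    and no_hamilton_cycle: "\<lbrakk>i \<in> T; \<And>v. v \<in> V \<Longrightarrow> d i v = 2; u \<in> V; (\<Sum>i\<in>T. d i u) = k;
      j \<in> T; j \<noteq> i; 0 < d j u\<rbrakk> \<Longrightarrow> False"
begin

lemma deficient_eq:
  assumes "\<And>i. i \<in> T \<Longrightarrow> v \<notin> deficient u i" "v \<in> V" "deg v = deg u" "i \<in> T"
  shows "d i v = d i u"
proof -
  have le: "d l u \<le> d l v" if "l \<in> T" for l using assms(1)[OF that] assms(2) by (auto simp: deficient_def)
  have "(\<Sum>i\<in>T. d i v - d i u) = 0" using assms(3) by (simp add: deg_def sum_subtractf)
  then have "\<forall>i\<in>T. d i v - d i u = 0"
    using finite_T le by (subst (asm) sum_nonneg_eq_0_iff) auto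
  then show ?thesis using assms(4) by simp
qed

text \<open>If deficient vertices exist, the set \<open>?R\<close> separates them from
  \<open>?A\<close>, the vertices with the degree vector of \<open>u\<close>; so \<open>?R\<close>
  has at least three elements and \<open>no_single\<close> gains enough. If none exist, the degree
  bounds fall short by 2, which is supplied by a further colour or else by excluding a 2-regular
  spanning colour.\<close>

lemma two_big_colours:
  assumes u: "u \<in> V" and tight: "deg u = k" and s2: "card (colours_at u) = 2"
    and big: "\<And>i. i \<in> colours_at u \<Longrightarrow> 2 \<le> d i u" and k: "4 \<le> k" "k \<le> 5"
  shows "k * n - 2 \<le> (\<Sum>i\<in>T. 2 * e i - 2)"
proof -
  let ?J = "colours_at u" and ?R = "{v \<in> V. (\<forall>i\<in>T. v \<notin> deficient u i) \<and> k < deg v}"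
  let ?A = "{v \<in> V. (\<forall>i\<in>T. v \<notin> deficient u i) \<and> deg v = k}"
  have tot: "(\<Sum>i\<in>T. 2 * e i - 2) = (\<Sum>i\<in>?J. 2 * e i) + (\<Sum>i\<in>T - ?J. 2 * e i - 2) - 4"
    using sum_edges_split[of u] s2 by (simp add: sum_subtractf)
  show ?thesis
  proof (cases "\<exists>i\<in>T. deficient u i \<noteq> {}")
    case True
    then obtain i v where iv: "i \<in> T" "v \<in> deficient u i" by blast
    have "k - 1 \<le> int (card ?R)"
    proof (rule separator[of ?A ?R u v])
      fix x y assume xy: "x \<in> ?A" "y \<in> V" "N x y"
      \<comment> \<open>\<open>x\<close> has the degree vector of \<open>u\<close>, hence is tight
        as well, and a neighbour of a tight vertex is never deficient against it.\<close>
      have "y \<notin> deficient u l" if l: "l \<in> T" for l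
      proof
        assume "y \<in> deficient u l"
        moreover have "d l x = d l u" using deficient_eq[of x u l] xy l tight by auto
        ultimately have "y \<in> deficient x l" by (simp add: deficient_def)
        then show False using deficient_not_adjacent(2)[of x l y] xy l by auto
      qed
      moreover have "k \<le> deg y" using deg_ge xy by blast
      ultimately show "y \<in> ?A \<union> ?R" using xy by auto
    qed (use u tight iv deficient_subset in \<open>auto simp: deficient_def\<close>)
    then show ?thesis using no_single[OF u tight] k tot by auto
  next
    case False
    have edges: "d i u * n \<le> 2 * e i" if "i \<in> T" for i
      using tight_edges[OF u tight that] False that by simp
    have lower: "d i u \<le> d i v" if "i \<in> T" "v \<in> V" for i v
      using False that leI by (auto simp: deficient_def)
    obtain a b where ab: "?J = {a, b}" "a \<noteq> b" using s2 by (auto simp: card_2_iff)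
    have abT: "a \<in> T" "b \<in> T" using ab colours_at_subset[of u] by auto
    have sumJ: "d a u + d b u = k" using sum_d_tight[OF u tight] ab by simp
    show ?thesis
    proof (cases "T = ?J")
      case False
      have "k * n \<le> (\<Sum>i\<in>?J. 2 * e i)"
        using edges[OF abT(1)] edges[OF abT(2)] ab sumJ by (simp add: distrib_right flip: sumJ)
      then show ?thesis using tot outer_edges_ge[OF False] by simp
    next
      case True
      \<comment> \<open>If the bound \<open>k * n + 2\<close> fails, a colour with two edges at
        \<open>u\<close> has exactly \<open>n\<close> edges and is therefore 2-regular on all of
        \<open>V\<close>.\<close>
      have no_two: False if "?J = {i, j}" "i \<noteq> j" "d i u = 2" "2 * e i + 2 * e j < k * n + 2" for i j
      proof -
        have T: "i \<in> T" "j \<in> T" "0 < d j u" using that(1) colours_at_subset[of u] by (auto simp: colours_at_def)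
        have kk: "d i u + d j u = k" using sum_d_tight[OF u tight] that by simp
        have "2 * e i < 2 * n + 2"
          using edges[OF T(2)] that(3,4) kk by (simp add: algebra_simps flip: kk)
        then have ei: "e i = n" using edges[OF T(1)] that(3) by simp
        have "(\<Sum>v\<in>V. d i v - 2) = 0" using handshake[OF T(1)] ei by (simp add: sum_subtractf)
        then have "\<forall>v\<in>V. d i v - 2 = 0"
          using finite_V lower[OF T(1)] that(3) by (subst (asm) sum_nonneg_eq_0_iff) auto
        then show False
          using no_hamilton_cycle[of i u j] T u tight that(2) by (auto simp: deg_def)
      qed
      \<comment> \<open>Two summands that are at least 2 and add up to at most 5 cannot both exceed
        2.\<close>
      have "d a u = 2 \<or> d b u = 2" using big[of a] big[of b] ab sumJ k by auto
      then have "k * n + 2 \<le> 2 * e a + 2 * e b"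
        using no_two[of a b] no_two[of b a] ab by (auto simp: insert_commute not_less[symmetric])
      then show ?thesis using tot ab True by simp
    qed
  qed
qed

theorem edge_bound:
  assumes k5: "k \<le> 5"
  shows "k * n - 2 \<le> (\<Sum>i\<in>T. 2 * e i - 2)"
proof (cases "\<exists>u\<in>V. deg u = k")
  case False
  then show ?thesis using no_tight[OF _ k5] deg_ge by force
next
  case True
  then obtain u where u: "u \<in> V" and tight: "deg u = k" by blast
  let ?J = "colours_at u"
  define s where "s = int (card ?J)"
  have fin: "finite (singles u)" using finite_subset[OF singles_subset[OF u tight] finite_colours_at] .
  consider "k + 2 \<le> 2 * s" | "2 \<le> card (singles u)" | "2 * s \<le> k + 1" "card (singles u) = 1"
    | "card (singles u) = 0" by linarith
  then show ?thesis
  proof cases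
    case 1
    then show ?thesis using many_colours[OF u tight] by (simp add: s_def)
  next
    case 2
    then show ?thesis using two_singles[OF u tight] by simp
  next
    case 3
    \<comment> \<open>For \<open>k = 2\<close> the only colour at \<open>u\<close> would have degree
      one there, contradicting \<open>deg u = 2\<close>.\<close>
    have "3 \<le> k"
    proof (rule ccontr)
      assume "\<not> 3 \<le> k"
      then have k2: "k = 2" using k_ge by simp
      then have "s \<le> 1" using 3 by simp
      moreover have "singles u \<subseteq> ?J" using singles_subset[OF u tight] .
      ultimately have "singles u = ?J"
        using 3(2) card_seteq[OF finite_colours_at] by (simp add: s_def)
      then have "(\<Sum>i\<in>?J. d i u) = (\<Sum>i\<in>?J. 1)"
        by (intro sum.cong) (auto simp: singles_def[OF u tight])
      then show False using sum_d_tight[OF u tight] k2 3(2) \<open>singles u = ?J\<close> by simp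
    qed
    then show ?thesis using one_single[OF u tight 3(2)] 3(1) by (simp add: s_def)
  next
    case 4
    have big: "2 \<le> d i u" if "i \<in> ?J" for i
    proof -
      have "i \<notin> singles u" using 4 fin by auto
      then show ?thesis using that by (auto simp: singles_def[OF u tight] colours_at_def)
    qed
    have "(\<Sum>i\<in>?J. 2) \<le> (\<Sum>i\<in>?J. d i u)" using big by (rule sum_mono)
    then have sk: "2 * s \<le> k" using sum_d_tight[OF u tight] by (simp add: s_def)
    have "s \<noteq> 0" using sum_d_tight[OF u tight] k_ge finite_colours_at[of u] by (auto simp: s_def)
    then consider "s = 1" | "s = 2" using sk k5 by (fastforce simp: s_def)
    then show ?thesis
    proof cases
      case 2
      then show ?thesis using two_big_colours[OF u tight] big sk k5 by (auto simp: s_def)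
    next
      case 1
      then obtain i where i: "?J = {i}" by (auto simp: s_def card_1_singleton_iff)
      then have iT: "i \<in> T" using colours_at_subset by blast
      have tot: "(\<Sum>i\<in>T. 2 * e i - 2) = 2 * e i - 2 + (\<Sum>i\<in>T - ?J. 2 * e i - 2)"
        using sum_edges_split[of u] i by simp
      show ?thesis
      proof (cases "3 \<le> k")
        case True
        then show ?thesis using no_single[OF u tight] tot i by simp
      next
        case False
        then have k2: "k = 2" using k_ge by simp
        show ?thesis
        proof (cases "T = ?J")
          case True
          have "(\<Sum>v\<in>V. k) \<le> (\<Sum>v\<in>V. deg v)" using deg_ge by (rule sum_mono)
          also have "\<dots> = 2 * e i"
            using handshake[OF iT] sum.cong[OF trans[OF True i] refl, of "\<lambda>i. d i _"] by (simp add: deg_def)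
          finally show ?thesis using tot True by (simp add: mult.commute)
        next
          case False
          \<comment> \<open>Even deficient vertices see colour \<open>i\<close>, as
            \<open>d i u - 1 \<ge> 1\<close>. Its class is thus connected and spanning with at least
            \<open>n - 1\<close> edges, and a further colour supplies the missing 2.\<close>
          have "V \<subseteq> supp i"
          proof
            fix v assume v: "v \<in> V"
            then show "v \<in> supp i"
              using deficient_value[OF u tight iT, of v] big[of i] i
              by (cases "v \<in> deficient u i") (auto simp: supp_def deficient_def)
          qed
          then have "supp i = V" using supp_subset by blast
          then have "n \<le> e i + 1" using card_supp_le_edges[OF iT] by simp
          then show ?thesis using tot outer_edges_ge[OF False] k2 by simp
        qed
      qed
    qed
  qed
qed

end

section \<open>Menger's theorem\<close>

definition dipath :: "('a \<times> 'a) set \<Rightarrow> 'a list \<Rightarrow> bool" where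
  "dipath E p \<longleftrightarrow> p \<noteq> [] \<and> distinct p \<and> successively (\<lambda>x y. (x, y) \<in> E) p"

text \<open>\<open>Z\<close> plays the role of the set of vertices reachable from \<open>A\<close> without entering \<open>X\<close>.\<close>

definition separates :: "('a \<times> 'a) set \<Rightarrow> 'a set \<Rightarrow> 'a set \<Rightarrow> 'a set \<Rightarrow> bool" where
  "separates E A B X \<longleftrightarrow> (\<exists>Z. A - X \<subseteq> Z \<and> Z \<inter> X = {} \<and> Z \<inter> B = {} \<and>
     (\<forall>x y. (x, y) \<in> E \<longrightarrow> x \<in> Z \<longrightarrow> y \<in> Z \<union> X))"

lemma successively_closed:
  assumes "successively (\<lambda>x y. (x, y) \<in> E) p" "p \<noteq> []" "hd p \<in> Z"
    and "\<And>x y. (x, y) \<in> E \<Longrightarrow> x \<in> Z \<Longrightarrow> y \<in> Z \<union> X" "set (tl p) \<inter> X = {}"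
  shows "set p \<subseteq> Z"
  using assms
proof (induction p rule: induct_list012)
  case (3 x y zs)
  then show ?case by fastforce
qed auto

lemma disjoint_paths_inj_on:
  assumes "\<And>p. p \<in> P \<Longrightarrow> p \<noteq> []" "\<And>p q. \<lbrakk>p \<in> P; q \<in> P; p \<noteq> q\<rbrakk> \<Longrightarrow> set p \<inter> set q = {}"
  shows "inj_on last P" "inj_on hd P"
proof -
  show "inj_on last P" unfolding inj_on_def using assms by (metis disjoint_iff last_in_set)
  show "inj_on hd P" unfolding inj_on_def using assms by (metis disjoint_iff hd_in_set)
qed

lemma inj_on_image_eq_obtain:
  assumes "finite B" "inj_on f P" "f ` P \<subseteq> B" "card P = card B"
  obtains g where "\<And>b. b \<in> B \<Longrightarrow> g b \<in> P \<and> f (g b) = b"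
proof -
  have "f ` P = B" using assms by (metis card_image card_subset_eq)
  then show ?thesis using that[of "inv_into P f"] by (metis f_inv_into_f inv_into_into)
qed

text \<open>
  Goering's proof: if deleting the edge \<open>(x, y)\<close> admits a separator \<open>S\<close> with fewer than \<open>k\<close>
  elements, then \<open>S \<union> {x}\<close> and \<open>S \<union> {y}\<close> have \<open>k\<close> elements, are linked to \<open>A\<close> and \<open>B\<close> by
  induction, and the two linkages are glued along \<open>S\<close> and \<open>(x, y)\<close>.
\<close>

theorem menger_sets:
  assumes "finite E" "finite A" "finite B"
    and "\<And>X. finite X \<Longrightarrow> separates E A B X \<Longrightarrow> k \<le> card X"
  shows "\<exists>P. card P = k \<and> finite P \<and> (\<forall>p\<in>P. dipath E p \<and> hd p \<in> A \<and> last p \<in> B) \<and>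
    (\<forall>p\<in>P. \<forall>q\<in>P. p \<noteq> q \<longrightarrow> set p \<inter> set q = {})"
  using assms
proof (induction E arbitrary: A B rule: finite_induct)
  case empty
  have "separates {} A B (A \<inter> B)" unfolding separates_def by (intro exI[of _ "A - B"]) auto
  then have "k \<le> card (A \<inter> B)" using empty by simp
  then obtain C where C: "C \<subseteq> A \<inter> B" "card C = k" "finite C" by (metis obtain_subset_with_card_n)
  show ?case
    by (rule exI[of _ "(\<lambda>x. [x]) ` C"]) (use C in \<open>auto simp: card_image inj_on_def dipath_def\<close>)
next
  case (insert e E)
  obtain x y where e: "e = (x, y)" by (cases e)
  show ?case
  proof (cases "\<forall>X. finite X \<longrightarrow> separates E A B X \<longrightarrow> k \<le> card X")
    case True
    then obtain P where P: "card P = k" "finite P" "\<forall>p\<in>P. dipath E p \<and> hd p \<in> A \<and> last p \<in> B"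
        "\<forall>p\<in>P. \<forall>q\<in>P. p \<noteq> q \<longrightarrow> set p \<inter> set q = {}"
      using insert.IH[of A B] insert.prems by blast
    moreover have "dipath (insert e E) p" if "dipath E p" for p
      using that successively_mono[of "\<lambda>x y. (x, y) \<in> E" p "\<lambda>x y. (x, y) \<in> insert e E"] by (simp add: dipath_def)
    ultimately show ?thesis by blast
  next
    case False
    then obtain S where S: "finite S" "separates E A B S" "card S < k" by force
    then obtain Z where Z: "A - S \<subseteq> Z" "Z \<inter> S = {}" "Z \<inter> B = {}"
        "\<And>a b. \<lbrakk>(a, b) \<in> E; a \<in> Z\<rbrakk> \<Longrightarrow> b \<in> Z \<union> S"
      unfolding separates_def by blast
    \<comment> \<open>Adding either end of the new edge to \<open>S\<close> blocks that
      edge.\<close>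
    have "separates (insert e E) A B (insert x S)"
      unfolding separates_def by (rule exI[of _ "Z - {x}"]) (use Z e in fast)
    then have kx: "k \<le> card (insert x S)" using insert.prems S by simp
    have "separates (insert e E) A B (insert y S)"
      unfolding separates_def by (rule exI[of _ "Z - {y}"]) (use Z e in fast)
    then have ky: "k \<le> card (insert y S)" using insert.prems S by simp
    have xS: "x \<notin> S" "card (insert x S) = k" using kx S by (auto simp: card_insert_if split: if_splits)
    have yS: "y \<notin> S" "card (insert y S) = k" using ky S by (auto simp: card_insert_if split: if_splits)
    have "k \<le> card X" if X: "finite X" "separates E A (insert x S) X" for X
    proof -
      obtain Y where Y: "A - X \<subseteq> Y" "Y \<inter> X = {}" "Y \<inter> insert x S = {}"
          "\<And>a b. \<lbrakk>(a, b) \<in> E; a \<in> Y\<rbrakk> \<Longrightarrow> b \<in> Y \<union> X"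
        using X unfolding separates_def by blast
      \<comment> \<open>\<open>Y\<close> avoids \<open>x\<close> and \<open>S\<close>, so no step
        leaves \<open>Y \<inter> Z\<close> along the new edge or into \<open>S\<close>.\<close>
      have "separates (insert e E) A B X"
        unfolding separates_def by (rule exI[of _ "Y \<inter> Z"]) (use Y Z e in blast)
      then show ?thesis using insert.prems X by simp
    qed
    then have "\<exists>P. card P = k \<and> finite P \<and> (\<forall>p\<in>P. dipath E p \<and> hd p \<in> A \<and> last p \<in> insert x S) \<and>
        (\<forall>p\<in>P. \<forall>q\<in>P. p \<noteq> q \<longrightarrow> set p \<inter> set q = {})"
      by (intro insert.IH) (use insert.prems S in auto)
    then obtain P where P: "card P = k" "finite P" "\<And>p. p \<in> P \<Longrightarrow> dipath E p \<and> hd p \<in> A \<and> last p \<in> insert x S"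
        "\<And>p q. \<lbrakk>p \<in> P; q \<in> P; p \<noteq> q\<rbrakk> \<Longrightarrow> set p \<inter> set q = {}"
      by blast
    have "k \<le> card X" if X: "finite X" "separates E (insert y S) B X" for X
    proof -
      obtain Y where Y: "insert y S - X \<subseteq> Y" "Y \<inter> X = {}" "Y \<inter> B = {}"
          "\<And>a b. \<lbrakk>(a, b) \<in> E; a \<in> Y\<rbrakk> \<Longrightarrow> b \<in> Y \<union> X"
        using X unfolding separates_def by blast
      \<comment> \<open>Edges of \<open>E\<close> leaving \<open>Z\<close> end in \<open>S\<close>,
        and the new edge ends in \<open>y\<close>; these targets lie in \<open>Y\<close> or
        \<open>X\<close>, so \<open>Y \<union> Z\<close> can only be left into
        \<open>X\<close>.\<close>
      have "separates (insert e E) A B X"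
        unfolding separates_def
      proof (intro exI[of _ "(Y \<union> Z) - X"] conjI allI impI)
        show "(Y \<union> Z - X) \<inter> B = {}" using Y(3) Z(3) by blast
        fix a b assume "(a, b) \<in> insert e E" "a \<in> Y \<union> Z - X"
        then show "b \<in> Y \<union> Z - X \<union> X" using Y(1) Y(4)[of a b] Z(4)[of a b] e by auto
      qed (use Y(1) Z(1) in auto)
      then show ?thesis using insert.prems X by simp
    qed
    then have "\<exists>P. card P = k \<and> finite P \<and> (\<forall>p\<in>P. dipath E p \<and> hd p \<in> insert y S \<and> last p \<in> B) \<and>
        (\<forall>p\<in>P. \<forall>q\<in>P. p \<noteq> q \<longrightarrow> set p \<inter> set q = {})"
      by (intro insert.IH) (use insert.prems S in auto)
    then obtain Q where Q: "card Q = k" "finite Q" "\<And>p. p \<in> Q \<Longrightarrow> dipath E p \<and> hd p \<in> insert y S \<and> last p \<in> B"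
        "\<And>p q. \<lbrakk>p \<in> Q; q \<in> Q; p \<noteq> q\<rbrakk> \<Longrightarrow> set p \<inter> set q = {}"
      by blast
    have Pne: "p \<noteq> []" if "p \<in> P" for p using P(3)[OF that] by (simp add: dipath_def)
    have Qne: "q \<noteq> []" if "q \<in> Q" for q using Q(3)[OF that] by (simp add: dipath_def)
    obtain f where f: "\<And>s. s \<in> insert x S \<Longrightarrow> f s \<in> P \<and> last (f s) = s"
      using inj_on_image_eq_obtain[of "insert x S" last P] disjoint_paths_inj_on(1)[of P] Pne P S xS by auto
    obtain g where g: "\<And>s. s \<in> insert y S \<Longrightarrow> g s \<in> Q \<and> hd (g s) = s"
      using inj_on_image_eq_obtain[of "insert y S" hd Q] disjoint_paths_inj_on(2)[of Q] Qne Q S yS by auto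
    have fP: "dipath E (f s)" "f s \<noteq> []" "hd (f s) \<in> A" "last (f s) = s" if "s \<in> insert x S" for s
      using f[OF that] P(3) Pne by auto
    have gQ: "dipath E (g s)" "g s \<noteq> []" "last (g s) \<in> B" "hd (g s) = s" if "s \<in> insert y S" for s
      using g[OF that] Q(3) Qne by auto
    have f_disj: "set (f s) \<inter> set (f t) = {}" if "s \<in> insert x S" "t \<in> insert x S" "s \<noteq> t" for s t
      using f[OF that(1)] f[OF that(2)] P(4) that(3) by metis
    have g_disj: "set (g s) \<inter> set (g t) = {}" if "s \<in> insert y S" "t \<in> insert y S" "s \<noteq> t" for s t
      using g[OF that(1)] g[OF that(2)] Q(4) that(3) by metis
    have f_S: "v = s" if "s \<in> insert x S" "v \<in> set (f s)" "v \<in> S" for s v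
      using f_disj[of s v] fP[of v] that last_in_set[of "f v"] by (metis IntI empty_iff insertCI)
    have g_S: "v = s" if "s \<in> insert y S" "v \<in> set (g s)" "v \<in> S" for s v
      using g_disj[of s v] gQ[of v] that hd_in_set[of "g v"] by (metis IntI empty_iff insertCI)
    text \<open>A common vertex outside \<open>S\<close> would yield an \<open>A\<close>-\<open>B\<close> path in \<open>E\<close> avoiding \<open>S\<close>.\<close>
    have meet: "v = s \<and> v = t \<and> v \<in> S"
      if st: "s \<in> insert x S" "t \<in> insert y S" and v: "v \<in> set (f s)" "v \<in> set (g t)" for s t v
    proof (cases "v \<in> S")
      case True
      then show ?thesis using f_S g_S st v by blast
    next
      case False
      obtain p1 p2 where p: "f s = p1 @ v # p2" using v(1) by (meson split_list)
      obtain q1 q2 where q: "g t = q1 @ v # q2" using v(2) by (meson split_list)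
      have "set (p1 @ [v]) \<inter> S = {}"
      proof -
        have "w \<notin> S" if "w \<in> set p1" for w
        proof
          assume "w \<in> S"
          then have "w = s" using f_S[OF st(1)] that p by simp
          moreover have "s \<in> set (v # p2)" using fP(4)[OF st(1)] p last_in_set[of "v # p2"] by simp
          ultimately show False using fP(1)[OF st(1)] that p by (auto simp: dipath_def)
        qed
        then show ?thesis using False by auto
      qed
      moreover have "hd (p1 @ [v]) \<in> A" using fP(3)[OF st(1)] p by (cases p1) auto
      moreover have "successively (\<lambda>x y. (x, y) \<in> E) (p1 @ [v])"
        using fP(1)[OF st(1)] p by (auto simp: dipath_def successively_append_iff)
      ultimately have "set (p1 @ [v]) \<subseteq> Z"
        using Z(1,4) by (cases p1; intro successively_closed[of E _ Z S]) auto
      then have vZ: "v \<in> Z" by simp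
      have "set q2 \<inter> S = {}"
      proof -
        have "w \<notin> S" if "w \<in> set q2" for w
        proof
          assume "w \<in> S"
          then have "w = t" using g_S[OF st(2)] that q by simp
          moreover have "t \<in> set (q1 @ [v])" using gQ(4)[OF st(2)] q by (cases q1) auto
          ultimately show False using gQ(1)[OF st(2)] that q by (auto simp: dipath_def)
        qed
        then show ?thesis by auto
      qed
      moreover have "successively (\<lambda>x y. (x, y) \<in> E) (v # q2)"
        using gQ(1)[OF st(2)] q by (auto simp: dipath_def successively_append_iff)
      ultimately have "set (v # q2) \<subseteq> Z"
        using Z(4) vZ by (intro successively_closed[of E _ Z S]) auto
      moreover have "last (v # q2) \<in> B" using gQ(3)[OF st(2)] q by simp
      ultimately show ?thesis using Z(3) last_in_set[of "v # q2"] by blast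
    qed
    define R where "R s = (if s = x then f x @ g y else f s @ tl (g s))" for s
    have R_set: "set (R s) \<subseteq> set (f s) \<union> set (g (if s = x then y else s))" if "s \<in> insert x S" for s
      unfolding R_def by (cases "g s") auto
    have R_path: "dipath (insert e E) (R s) \<and> hd (R s) \<in> A \<and> last (R s) \<in> B" if s: "s \<in> insert x S" for s
    proof (cases "s = x")
      case True
      have "set (f x) \<inter> set (g y) = {}" using meet[of x y] xS by auto
      moreover have "successively (\<lambda>x y. (x, y) \<in> insert e E) (f x)" "successively (\<lambda>x y. (x, y) \<in> insert e E) (g y)"
        using fP(1)[of x] gQ(1)[of y] by (auto simp: dipath_def elim: successively_mono)
      ultimately show ?thesis
        using True fP[of x] gQ[of y] e by (auto simp: R_def dipath_def successively_append_iff)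
    next
      case False
      then have sS: "s \<in> S" using s by simp
      obtain q where q: "g s = s # q" using gQ[of s] sS by (metis hd_Cons_tl insertCI)
      have "set (f s) \<inter> set q = {}"
        using meet[of s s] sS q gQ(1)[of s] by (auto simp: dipath_def)
      moreover have "successively (\<lambda>x y. (x, y) \<in> insert e E) (f s)" "successively (\<lambda>x y. (x, y) \<in> insert e E) (s # q)"
        using fP(1)[of s] gQ(1)[of s] sS q by (auto simp: dipath_def elim: successively_mono)
      ultimately show ?thesis
        using False sS fP[of s] gQ[of s] q
        by (cases q) (auto simp: R_def dipath_def successively_append_iff)
    qed
    have R_disj: "set (R s) \<inter> set (R t) = {}" if st: "s \<in> insert x S" "t \<in> insert x S" "s \<noteq> t" for s t
    proof (rule ccontr)
      assume "set (R s) \<inter> set (R t) \<noteq> {}"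
      then obtain v where v: "v \<in> set (R s)" "v \<in> set (R t)" by auto
      let ?h = "\<lambda>s. if s = x then y else s"
      have h: "?h s \<in> insert y S" "?h t \<in> insert y S" "?h s \<noteq> ?h t" using st yS by auto
      consider "v \<in> set (f s)" "v \<in> set (f t)" | "v \<in> set (g (?h s))" "v \<in> set (g (?h t))"
        | "v \<in> set (f s)" "v \<in> set (g (?h t))" | "v \<in> set (f t)" "v \<in> set (g (?h s))"
        using v R_set[OF st(1)] R_set[OF st(2)] by blast
      then show False
      proof cases
        case 1 then show False using f_disj[OF st] by auto
      next
        case 2 then show False using g_disj[OF h] by auto
      next
        case 3
        from meet[OF st(1) h(2) this] st xS yS show False by (auto split: if_splits)
      next
        case 4
        from meet[OF st(2) h(1) this] st xS yS show False by (auto split: if_splits)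
      qed
    qed
    have "inj_on R (insert x S)"
    proof (rule inj_onI, rule ccontr)
      fix s t assume "s \<in> insert x S" "t \<in> insert x S" "R s = R t" "s \<noteq> t"
      then show False using R_disj[of s t] R_path[of t] by (simp add: dipath_def)
    qed
    then have "card (R ` insert x S) = k" using xS card_image by metis
    moreover have "set p \<inter> set q = {}" if "p \<in> R ` insert x S" "q \<in> R ` insert x S" "p \<noteq> q" for p q
      using that R_disj by blast
    ultimately show ?thesis using R_path S(1) by (intro exI[of _ "R ` insert x S"]) blast
  qed
qed

section \<open>From linked sets to internally disjoint paths between two vertices\<close>

lemma is_path_successively:
  "is_path V E u v p \<longleftrightarrow> p \<noteq> [] \<and> hd p = u \<and> last p = v \<and> distinct p \<and> set p \<subseteq> V \<and>
    successively (\<lambda>x y. {x, y} \<in> E) p"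
  by (auto simp: is_path_def successively_conv_nth)

lemma path_closed:
  assumes "is_path U E u v p" "u \<in> M"
    and "\<And>x y. \<lbrakk>x \<in> M; y \<in> U; {x, y} \<in> E\<rbrakk> \<Longrightarrow> y \<in> M"
  shows "v \<in> M"
proof -
  have p: "p \<noteq> []" "hd p = u" "last p = v" "set p \<subseteq> U" "successively (\<lambda>x y. {x, y} \<in> E) p"
    using assms(1) by (auto simp: is_path_successively)
  have "successively (\<lambda>x y. (x, y) \<in> {(x, y). y \<in> U \<and> {x, y} \<in> E}) p"
    using p(4,5) by (auto simp: successively_conv_nth)
  then have "set p \<subseteq> M"
    by (rule successively_closed[where X = "{}"]) (use p assms in auto)
  then show ?thesis using p last_in_set by blast
qed

text \<open>\<open>menger_sets\<close> links the neighbours of \<open>u\<close> to those of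
  \<open>v\<close> in the graph without \<open>u\<close> and \<open>v\<close>. If \<open>u\<close>
  and \<open>v\<close> are adjacent, their edge is one of the paths, so only \<open>k - 1\<close>
  others are sought.\<close>

theorem k_connected_disjoint_paths:
  assumes "graph V F" "k_connected k V F" "1 \<le> k" and u: "u \<in> V" and v: "v \<in> V" and uv: "u \<noteq> v"
  shows "\<exists>P. finite P \<and> card P = k \<and> (\<forall>p\<in>P. is_path V F u v p) \<and>
    (\<forall>p\<in>P. \<forall>q\<in>P. p \<noteq> q \<longrightarrow> interior p \<inter> interior q = {})"
proof -
  define W where "W = V - {u, v}"
  define D where "D = {(a, b). a \<in> W \<and> b \<in> W \<and> {a, b} \<in> F}"
  define A where "A = {a \<in> W. {u, a} \<in> F}"
  define B where "B = {b \<in> W. {b, v} \<in> F}"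
  define k' where "k' = (if {u, v} \<in> F then k - 1 else k)"
  have finV: "finite V" and loop: "{x} \<notin> F" for x
    using assms(1) unfolding graph_def by auto
  have finW: "finite W" "W \<subseteq> V" using finV by (auto simp: W_def)
  have conn: "\<exists>p. is_path (V - S) (induced_edges F (V - S)) x y p"
    if "S \<subseteq> V" "card S \<le> k - 1" "x \<in> V - S" "y \<in> V - S" for S x y
    using assms(2) that unfolding k_connected_def connected_graph_def by blast
  have cardV: "k + 1 \<le> card V" using assms(2) by (simp add: k_connected_def)
  have sep: "k' \<le> card X" if X: "finite X" "separates D A B X" for X
  proof (rule ccontr)
    assume "\<not> k' \<le> card X"
    define Y where "Y = X \<inter> W"
    have "card Y \<le> card X" using X by (auto simp: Y_def intro: card_mono)
    then have Y: "card Y < k'" using \<open>\<not> k' \<le> card X\<close> by simp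
    have YW: "Y \<subseteq> V" "u \<notin> Y" "v \<notin> Y" "finite Y" using X finW by (auto simp: Y_def W_def)
    obtain Z where Z: "A - X \<subseteq> Z" "Z \<inter> X = {}" "Z \<inter> B = {}"
        "\<And>x y. \<lbrakk>(x, y) \<in> D; x \<in> Z\<rbrakk> \<Longrightarrow> y \<in> Z \<union> X"
      using X unfolding separates_def by blast
    have from_u: "y \<in> Z \<inter> W" if "y \<in> V - Y" "{u, y} \<in> F" "y \<noteq> v" for y
    proof -
      have "y \<in> W" using that loop[of u] by (auto simp: W_def)
      then show ?thesis using that Z(1) by (auto simp: A_def Y_def)
    qed
    have from_Z: "y \<in> Z \<inter> W" if "x \<in> Z \<inter> W" "y \<in> V - Y" "{x, y} \<in> F" "y \<noteq> u" for x y
    proof -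
      have "y \<noteq> v" using that Z(3) by (auto simp: B_def)
      then have "y \<in> W" using that by (auto simp: W_def)
      then show ?thesis using that Z(4)[of x y] by (auto simp: D_def Y_def)
    qed
    have from_uZ: "y \<in> insert u (Z \<inter> W)"
      if "x \<in> insert u (Z \<inter> W)" "y \<in> V - Y" "{x, y} \<in> F" "x = u \<Longrightarrow> y \<noteq> v" for x y
      using from_u[of y] from_Z[of x y] that by (cases "x = u"; cases "y = u") auto
    have induced: "{x, y} \<in> F" if "{x, y} \<in> induced_edges F U" for x y U
      using that by (simp add: induced_edges_def)
    show False
    proof (cases "{u, v} \<in> F")
      case False
      then have "card Y \<le> k - 1" using Y by (simp add: k'_def)
      then obtain p where "is_path (V - Y) (induced_edges F (V - Y)) u v p"
        using conn[of Y u v] YW u v by auto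
      then have "v \<in> insert u (Z \<inter> W)"
      proof (rule path_closed)
        fix x y assume xy: "x \<in> insert u (Z \<inter> W)" "y \<in> V - Y" "{x, y} \<in> induced_edges F (V - Y)"
        show "y \<in> insert u (Z \<inter> W)"
          using from_uZ[OF xy(1,2) induced[OF xy(3)]] induced[OF xy(3)] False by blast
      qed simp
      then show False using uv by (auto simp: W_def)
    next
      case True
      then have Y1: "card Y < k - 1" using Y by (simp add: k'_def)
      \<comment> \<open>The edge between \<open>u\<close> and \<open>v\<close> cannot be cut by
        deleting \<open>Y\<close>, so a third vertex \<open>w\<close> outside \<open>Y\<close> is
        chosen: either \<open>w\<close> is cut off from \<open>v\<close> by deleting
        \<open>u\<close> as well, or \<open>u\<close> from \<open>w\<close> by deleting
        \<open>v\<close> as well.\<close>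
      have "card (Y \<union> {u, v}) \<le> card Y + card {u, v}" by (rule card_Un_le)
      then have "card (Y \<union> {u, v}) < card V" using Y1 cardV uv by simp
      then have "\<not> V \<subseteq> Y \<union> {u, v}" using YW card_mono[of "Y \<union> {u, v}" V] by auto
      then obtain w where w: "w \<in> V" "w \<notin> Y" "w \<noteq> u" "w \<noteq> v" by auto
      show False
      proof (cases "w \<in> Z")
        case True
        have "card (insert u Y) \<le> k - 1" using Y1 YW by simp
        then obtain p where "is_path (V - insert u Y) (induced_edges F (V - insert u Y)) w v p"
          using conn[of "insert u Y" w v] YW u v uv w by auto
        then have "v \<in> Z \<inter> W"
        proof (rule path_closed)
          fix x y assume xy: "x \<in> Z \<inter> W" "y \<in> V - insert u Y" "{x, y} \<in> induced_edges F (V - insert u Y)"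
          then show "y \<in> Z \<inter> W" using from_Z[OF xy(1) _ induced[OF xy(3)]] by blast
        qed (use w True in \<open>simp add: W_def\<close>)
        then show False by (simp add: W_def)
      next
        case False
        have "card (insert v Y) \<le> k - 1" using Y1 YW by simp
        then obtain p where "is_path (V - insert v Y) (induced_edges F (V - insert v Y)) u w p"
          using conn[of "insert v Y" u w] YW u v uv w by auto
        then have "w \<in> insert u (Z \<inter> W)"
        proof (rule path_closed)
          fix x y assume xy: "x \<in> insert u (Z \<inter> W)" "y \<in> V - insert v Y"
            "{x, y} \<in> induced_edges F (V - insert v Y)"
          then show "y \<in> insert u (Z \<inter> W)" using from_uZ[OF xy(1) _ induced[OF xy(3)]] by blast
        qed simp
        then show False using w False by auto
      qed
    qed
  qed
  have "finite D" by (rule finite_subset[of _ "W \<times> W"]) (auto simp: D_def finW)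
  moreover have "finite A" "finite B" using finW by (auto simp: A_def B_def)
  ultimately obtain P where P: "card P = k'" "finite P"
      "\<And>p. p \<in> P \<Longrightarrow> dipath D p \<and> hd p \<in> A \<and> last p \<in> B"
      "\<And>p q. \<lbrakk>p \<in> P; q \<in> P; p \<noteq> q\<rbrakk> \<Longrightarrow> set p \<inter> set q = {}"
    using menger_sets[of D A B k'] sep by blast
  define f where "f p = u # p @ [v]" for p
  have int_f: "interior (f p) = set p" for p by (simp add: f_def interior_def butlast_append)
  have setW: "set p \<subseteq> W" if "p \<in> P" for p
  proof -
    have "successively (\<lambda>x y. (x, y) \<in> D) p" "p \<noteq> []" "hd p \<in> W"
      using P(3)[OF that] by (auto simp: dipath_def A_def)
    then show ?thesis by (rule successively_closed[where X = "{}"]) (auto simp: D_def)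
  qed
  have path_f: "is_path V F u v (f p)" if "p \<in> P" for p
  proof -
    have "successively (\<lambda>x y. {x, y} \<in> F) p"
      using P(3)[OF that] by (auto simp: dipath_def D_def elim: successively_mono)
    then show ?thesis
      using P(3)[OF that] setW[OF that] u v uv
      by (auto simp: is_path_successively f_def successively_Cons successively_append_iff dipath_def A_def B_def W_def)
  qed
  have card_f: "card (f ` P) = k'" using P(1) by (simp add: card_image inj_on_def f_def)
  have disj_f: "interior p \<inter> interior q = {}" if "p \<in> f ` P" "q \<in> f ` P" "p \<noteq> q" for p q
    using that P(4) int_f by (metis imageE)
  show ?thesis
  proof (cases "{u, v} \<in> F")
    case False
    then show ?thesis using P(2) card_f path_f disj_f by (intro exI[of _ "f ` P"]) (auto simp: k'_def)
  next
    case True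
    have "p \<noteq> []" if "p \<in> P" for p using P(3)[OF that] by (simp add: dipath_def)
    then have "[u, v] \<notin> f ` P" by (auto simp: f_def)
    then have "card (insert [u, v] (f ` P)) = k"
      using card_f P(2) True assms(3) by (simp add: k'_def)
    moreover have "is_path V F u v [u, v]" using True u v uv by (simp add: is_path_successively)
    moreover have "interior [u, v] = {}" by (simp add: interior_def)
    ultimately show ?thesis using P(2) path_f disj_f by (intro exI[of _ "insert [u, v] (f ` P)"]) auto
  qed
qed

section \<open>Colourings with connected classes\<close>

lemma graph_finite_edges:
  assumes "graph V E" shows "finite E"
proof (rule finite_subset)
  show "E \<subseteq> Pow V" using assms by (auto simp: graph_def)
qed (use assms in \<open>simp add: graph_def\<close>)

lemma interior_eq:
  assumes "is_path V E u v p" "u \<noteq> v"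
  shows "interior p = set p - {u, v}"
proof -
  obtain r where p: "p = u # r" using assms by (cases p) (auto simp: is_path_def)
  then have "r \<noteq> []" "last r = v" using assms by (auto simp: is_path_def split: if_splits)
  then obtain s where r: "r = s @ [v]" by (metis append_butlast_last_id)
  then have "distinct (u # s @ [v])" using assms p by (simp add: is_path_def)
  then show ?thesis by (auto simp: p r interior_def)
qed

lemma is_path_rev: "is_path V E u v p \<Longrightarrow> is_path V E v u (rev p)"
  by (auto simp: is_path_successively hd_rev last_rev insert_commute)

lemma path_length_ge: "is_path V E u v p \<Longrightarrow> u \<noteq> v \<Longrightarrow> 2 \<le> length p"
  by (cases p rule: remdups_adj.cases) (auto simp: is_path_def)

definition first_edge :: "'a list \<Rightarrow> 'a set" where
  "first_edge p = {p ! 0, p ! 1}"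

lemma first_edge_props:
  assumes "is_path V E u v p" "u \<noteq> v"
  shows "first_edge p \<in> E" "first_edge p = {u, p ! 1}" "p ! 1 \<in> set p" "p ! 1 \<noteq> u"
    and "p ! 1 = v \<Longrightarrow> p = [u, v]"
proof -
  have l: "2 \<le> length p" using path_length_ge[OF assms] .
  then obtain a b r where p: "p = a # b # r" by (metis Suc_le_length_iff numeral_2_eq_2)
  then show "first_edge p \<in> E" "first_edge p = {u, p ! 1}" "p ! 1 \<in> set p" "p ! 1 \<noteq> u"
    using assms by (auto simp: is_path_successively first_edge_def)
  show "p = [u, v]" if "p ! 1 = v"
    using assms that p by (cases r rule: rev_cases) (auto simp: is_path_def)
qed

text \<open>Paths with the same first edge share their second vertex; it is interior to both unless
  it is \<open>v\<close>, and then both paths are the single edge.\<close>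

lemma first_edge_inj_on:
  assumes "\<And>p. p \<in> P \<Longrightarrow> is_path V E u v p" "u \<noteq> v"
    and "\<And>p q. \<lbrakk>p \<in> P; q \<in> P; p \<noteq> q\<rbrakk> \<Longrightarrow> interior p \<inter> interior q = {}"
  shows "inj_on first_edge P"
proof (rule inj_onI)
  fix p q assume pq: "p \<in> P" "q \<in> P" "first_edge p = first_edge q"
  note P = first_edge_props[OF assms(1)[OF pq(1)] assms(2)] and Q = first_edge_props[OF assms(1)[OF pq(2)] assms(2)]
  have eq: "p ! 1 = q ! 1" using pq(3) P(2,4) Q(2,4) by (auto simp: doubleton_eq_iff)
  show "p = q"
  proof (cases "p ! 1 = v")
    case True
    then show ?thesis using P(5) Q(5) eq by simp
  next
    case False
    then have "p ! 1 \<in> interior p \<inter> interior q"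
      using interior_eq[OF assms(1)[OF pq(1)] assms(2)] interior_eq[OF assms(1)[OF pq(2)] assms(2)] P Q eq by auto
    then show ?thesis using assms(3) pq by blast
  qed
qed

text \<open>Any nonempty proper subset can be enlarged by an edge meeting it, which adds at most one vertex.\<close>

lemma card_Union_connected_edges:
  assumes "finite C" "C \<noteq> {}" "\<And>x. x \<in> C \<Longrightarrow> card x = 2"
    and conn: "\<And>D. \<lbrakk>D \<subset> C; D \<noteq> {}\<rbrakk> \<Longrightarrow> \<exists>x\<in>D. \<exists>y\<in>C - D. x \<inter> y \<noteq> {}"
  shows "card (\<Union>C) \<le> card C + 1"
proof -
  have "m < card C \<Longrightarrow> \<exists>D\<subseteq>C. card D = Suc m \<and> card (\<Union>D) \<le> Suc m + 1" for m
  proof (induction m)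
    case 0
    obtain x where "x \<in> C" using assms(2) by auto
    then show ?case using assms(3) by (intro exI[of _ "{x}"]) auto
  next
    case (Suc m)
    then obtain D where D: "D \<subseteq> C" "card D = Suc m" "card (\<Union>D) \<le> Suc m + 1" by auto
    have finD: "finite D" using D(1) assms(1) finite_subset by blast
    have "D \<noteq> C" using D(2) Suc.prems by auto
    then have "D \<subset> C" "D \<noteq> {}" using D by auto
    from conn[OF this] obtain x y where xy: "x \<in> D" "y \<in> C - D" "x \<inter> y \<noteq> {}" by blast
    have y2: "card y = 2" "finite y" using assms(3)[of y] xy card.infinite by fastforce+
    have finU: "finite (\<Union>D)" using finD D(1) assms(3) by (metis card.infinite finite_Union subsetD zero_neq_numeral)
    have "card (y - \<Union>D) < card y" using xy y2 by (intro psubset_card_mono) auto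
    moreover have "\<Union>(insert y D) = \<Union>D \<union> (y - \<Union>D)" by auto
    ultimately have "card (\<Union>(insert y D)) \<le> Suc (Suc m) + 1"
      using D(3) y2 card_Un_le[of "\<Union>D" "y - \<Union>D"] by simp
    then show ?case using D xy finD by (intro exI[of _ "insert y D"]) auto
  qed
  from this[of "card C - 1"] obtain D where "D \<subseteq> C" "card D = card C" "card (\<Union>D) \<le> card C + 1"
    using assms(1,2) by (auto simp: card_gt_0_iff)
  then show ?thesis using card_subset_eq[OF assms(1)] by auto
qed

text \<open>Connectedness of a class is stated on edges: no nonempty proper part of it is
  vertex-disjoint from the rest. \<open>card_Union_connected_edges\<close> takes it in this
  form.\<close>

locale connected_colouring =
  fixes V :: "'a set" and E :: "'a set set" and c :: "'a set \<Rightarrow> 'c" and k :: nat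
  assumes graph: "graph V E" and mono: "mono_k_connected_colouring k V E c"
    and k_ge: "2 \<le> k" and card_V: "k < card V"
    and connected: "\<lbrakk>D \<subset> {x \<in> E. c x = i}; D \<noteq> {}\<rbrakk> \<Longrightarrow> \<exists>x\<in>D. \<exists>y\<in>{x \<in> E. c x = i} - D. x \<inter> y \<noteq> {}"
begin

definition cls :: "'c \<Rightarrow> 'a set set" where "cls i = {x \<in> E. c x = i}"

definition T :: "'c set" where "T = {i \<in> c ` E. 2 \<le> card (cls i)}"

definition dg :: "'c \<Rightarrow> 'a \<Rightarrow> nat" where "dg i v = card {x \<in> cls i. v \<in> x}"

definition adj :: "'a \<Rightarrow> 'a \<Rightarrow> bool" where "adj x y \<longleftrightarrow> {x, y} \<in> E \<and> c {x, y} \<in> T"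

lemma finite_V: "finite V" using graph by (simp add: graph_def)

lemma edge_card: "x \<in> E \<Longrightarrow> card x = 2"
  using graph by (auto simp: graph_def)

lemma edge_subset: "x \<in> E \<Longrightarrow> x \<subseteq> V"
  using graph by (auto simp: graph_def)

lemma finite_E: "finite E"
  using graph_finite_edges[OF graph] .

lemma edge_at: assumes "x \<in> E" "u \<in> x" obtains v where "x = {u, v}" "u \<noteq> v" "v \<in> V"
proof -
  obtain a b where ab: "a \<noteq> b" "a \<in> V" "b \<in> V" "x = {a, b}" using graph assms(1) unfolding graph_def by blast
  show thesis
  proof (cases "u = a")
    case True
    then show ?thesis using that[of b] ab by auto
  next
    case False
    then show ?thesis using that[of a] ab assms(2) by auto
  qed
qed

lemma finite_cls: "finite (cls i)" using finite_E by (simp add: cls_def)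

lemma finite_T: "finite T" using finite_E by (simp add: T_def)

lemma family:
  assumes "u \<in> V" "v \<in> V" "u \<noteq> v"
  obtains P where "finite P" "card P = k" "\<And>p. p \<in> P \<Longrightarrow> is_path V E u v p" "\<And>p. p \<in> P \<Longrightarrow> monochromatic c p"
    "\<And>p q. \<lbrakk>p \<in> P; q \<in> P; p \<noteq> q\<rbrakk> \<Longrightarrow> interior p \<inter> interior q = {}"
proof -
  note mono[unfolded mono_k_connected_colouring_def, THEN bspec, OF assms(1), THEN bspec, OF assms(2), THEN mp, OF assms(3)]
  then show thesis using that by (elim exE conjE) simp
qed

lemma mono_edge_colour:
  assumes "is_path V E u v p" "u \<noteq> v" "monochromatic c p" "Suc i < length p"
  shows "c {p ! i, p ! Suc i} = c (first_edge p)"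
proof -
  have "Suc 0 < length p" using path_length_ge[OF assms(1,2)] by simp
  then show ?thesis using assms(3,4) unfolding monochromatic_def first_edge_def One_nat_def by blast
qed

lemma long_path_nontrivial:
  assumes p: "is_path V E u v p" "u \<noteq> v" "monochromatic c p" "p \<noteq> [u, v]"
  shows "c (first_edge p) \<in> T"
proof -
  have l: "2 < length p"
  proof (rule ccontr)
    assume "\<not> 2 < length p"
    then have "length p = 2" using path_length_ge[OF p(1,2)] by simp
    then obtain a b where "p = [a, b]" by (auto simp: length_Suc_conv numeral_2_eq_2)
    then show False using p by (auto simp: is_path_def)
  qed
  have E: "{p ! 0, p ! 1} \<in> E" "{p ! 1, p ! 2} \<in> E"
    using p(1) l by (simp_all add: is_path_def numeral_2_eq_2)
  have "c {p ! 1, p ! 2} = c (first_edge p)"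
    using mono_edge_colour[OF p(1-3), of 1] l by (simp add: numeral_2_eq_2)
  then have "{{p ! 0, p ! 1}, {p ! 1, p ! 2}} \<subseteq> cls (c (first_edge p))"
    using E by (auto simp: cls_def first_edge_def)
  moreover have "{p ! 0, p ! 1} \<noteq> {p ! 1, p ! 2}"
    using p(1) l by (auto simp: is_path_def doubleton_eq_iff nth_eq_iff_index_eq)
  ultimately have "2 \<le> card (cls (c (first_edge p)))"
    using card_mono[OF finite_cls, of "{{p ! 0, p ! 1}, {p ! 1, p ! 2}}" "c (first_edge p)"]
    by (simp add: numeral_2_eq_2)
  then show ?thesis using E by (auto simp: T_def first_edge_def)
qed

text \<open>Paths of colour \<open>i\<close> have distinct first and distinct last edges, so there
  are at most \<open>min (dg i u) (dg i v)\<close> of them. A path whose colour is outside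
  \<open>T\<close> can only be \<open>[u, v]\<close>, and only if \<open>adj u v\<close>
  fails.\<close>

lemma path_count:
  assumes u: "u \<in> V" and v: "v \<in> V" and uv: "u \<noteq> v"
  shows "k \<le> (\<Sum>i\<in>T. min (dg i u) (dg i v)) + of_bool (\<not> adj u v)"
proof -
  obtain P where P: "finite P" "card P = k" "\<And>p. p \<in> P \<Longrightarrow> is_path V E u v p" "\<And>p. p \<in> P \<Longrightarrow> monochromatic c p"
    "\<And>p q. \<lbrakk>p \<in> P; q \<in> P; p \<noteq> q\<rbrakk> \<Longrightarrow> interior p \<inter> interior q = {}"
    using family[OF assms] by metis
  define C where "C i = {p \<in> P. c (first_edge p) = i}" for i
  have inj: "inj_on first_edge P" using first_edge_inj_on[OF P(3) uv P(5)] by blast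
  have int_rev: "interior (rev p) = interior p" if "p \<in> P" for p
    using interior_eq[OF P(3)[OF that] uv] interior_eq[OF is_path_rev[OF P(3)[OF that]]] uv by auto
  have inj_rev: "inj_on (\<lambda>p. first_edge (rev p)) P"
  proof -
    have "inj_on first_edge (rev ` P)"
      by (rule first_edge_inj_on[of _ V E v u]) (use P(3,5) uv is_path_rev int_rev in force)+
    then show ?thesis using comp_inj_on[of rev P first_edge] by (simp add: comp_def)
  qed
  have bound: "card (C i) \<le> min (dg i u) (dg i v)" for i
  proof -
    have "card (C i) \<le> dg i u" unfolding dg_def
      by (rule card_inj_on_le[of first_edge])
        (use inj finite_E first_edge_props(1,2)[OF P(3) uv] in \<open>auto simp: C_def cls_def inj_on_def\<close>)
    moreover have "card (C i) \<le> dg i v" unfolding dg_def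
    proof (rule card_inj_on_le[of "\<lambda>p. first_edge (rev p)"])
      show "(\<lambda>p. first_edge (rev p)) ` C i \<subseteq> {x \<in> cls i. v \<in> x}"
      proof
        fix x assume "x \<in> (\<lambda>p. first_edge (rev p)) ` C i"
        then obtain p where p: "p \<in> P" "c (first_edge p) = i" "x = first_edge (rev p)" by (auto simp: C_def)
        note R = first_edge_props(1,2)[OF is_path_rev[OF P(3)[OF p(1)]] uv[symmetric]]
        have l: "2 \<le> length p" using path_length_ge[OF P(3)[OF p(1)] uv] .
        then have "rev p ! 0 = p ! Suc (length p - 2)" "rev p ! 1 = p ! (length p - 2)"
          using rev_nth[of 0 p] rev_nth[of 1 p] by (cases "p = []"; simp add: Suc_diff_Suc numeral_2_eq_2)+
        then have "first_edge (rev p) = {p ! (length p - 2), p ! Suc (length p - 2)}"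
          unfolding first_edge_def by (simp only: insert_commute)
        then have "c (first_edge (rev p)) = i"
          using mono_edge_colour[OF P(3)[OF p(1)] uv P(4)[OF p(1)], of "length p - 2"] l p(2) by simp
        then show "x \<in> {x \<in> cls i. v \<in> x}" using R p(3) by (auto simp: cls_def)
      qed
    qed (use inj_rev finite_E in \<open>auto simp: C_def cls_def inj_on_def\<close>)
    ultimately show ?thesis by simp
  qed
  define Q where "Q = {p \<in> P. c (first_edge p) \<notin> T}"
  have Q1: "Q \<subseteq> {[u, v]}" using long_path_nontrivial[OF P(3) uv P(4)] by (auto simp: Q_def)
  have "Q = {}" if "adj u v" using Q1 that by (auto simp: Q_def adj_def first_edge_def)
  then have cQ: "card Q \<le> of_bool (\<not> adj u v)" using card_mono[OF _ Q1] by auto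
  have "P = (\<Union>i\<in>T. C i) \<union> Q" by (auto simp: C_def Q_def)
  then have "k \<le> card (\<Union>i\<in>T. C i) + card Q" using P(2) card_Un_le by metis
  also have "card (\<Union>i\<in>T. C i) \<le> (\<Sum>i\<in>T. card (C i))" using finite_T by (rule card_UN_le)
  also have "\<dots> \<le> (\<Sum>i\<in>T. min (dg i u) (dg i v))" using bound by (rule sum_mono)
  finally show ?thesis using cQ by simp
qed

lemma sum_dg: "(\<Sum>i\<in>T. dg i u) = card {x \<in> E. u \<in> x \<and> c x \<in> T}"
proof -
  have "{x \<in> E. u \<in> x \<and> c x \<in> T} = (\<Union>i\<in>T. {x \<in> cls i. u \<in> x})" by (auto simp: cls_def)
  also have "card \<dots> = (\<Sum>i\<in>T. dg i u)" unfolding dg_def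
    using finite_T finite_E by (intro card_UN_disjoint) (auto simp: cls_def)
  finally show ?thesis ..
qed

lemma card_adj:
  assumes u: "u \<in> V" shows "card {v \<in> V. adj u v} = (\<Sum>i\<in>T. dg i u)"
proof -
  have "bij_betw (\<lambda>v. {u, v}) {v \<in> V. adj u v} {x \<in> E. u \<in> x \<and> c x \<in> T}"
    unfolding bij_betw_def
  proof
    show "inj_on (\<lambda>v. {u, v}) {v \<in> V. adj u v}" by (auto simp: inj_on_def doubleton_eq_iff)
    show "(\<lambda>v. {u, v}) ` {v \<in> V. adj u v} = {x \<in> E. u \<in> x \<and> c x \<in> T}"
    proof
      show "{x \<in> E. u \<in> x \<and> c x \<in> T} \<subseteq> (\<lambda>v. {u, v}) ` {v \<in> V. adj u v}"
      proof
        fix x assume x: "x \<in> {x \<in> E. u \<in> x \<and> c x \<in> T}"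
        then obtain v where "x = {u, v}" "v \<in> V" using edge_at[of x u] by blast
        then show "x \<in> (\<lambda>v. {u, v}) ` {v \<in> V. adj u v}" using x by (auto simp: adj_def)
      qed
    qed (auto simp: adj_def)
  qed
  from bij_betw_same_card[OF this] show ?thesis unfolding sum_dg .
qed

lemma sum_dg_vertices: "(\<Sum>v\<in>V. dg i v) = 2 * card (cls i)"
proof -
  have "(\<Sum>v\<in>V. dg i v) = (\<Sum>v\<in>V. \<Sum>x\<in>cls i. of_bool (v \<in> x))"
    using finite_cls by (simp add: dg_def Int_def)
  also have "\<dots> = (\<Sum>x\<in>cls i. \<Sum>v\<in>V. of_bool (v \<in> x))" by (rule sum.swap)
  also have "\<dots> = (\<Sum>x\<in>cls i. 2)"
    using finite_V edge_card edge_subset by (intro sum.cong) (auto simp: cls_def Int_absorb1)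
  finally show ?thesis by simp
qed

lemma dg_pos_iff: "0 < dg i v \<longleftrightarrow> v \<in> \<Union>(cls i)"
  using finite_cls by (auto simp: dg_def card_gt_0_iff)

lemma support_eq: "{v \<in> V. 0 < dg i v} = \<Union>(cls i)"
  using edge_subset unfolding dg_pos_iff by (auto simp: cls_def)

lemma card_support_le:
  assumes "i \<in> T" shows "card {v \<in> V. 0 < dg i v} \<le> card (cls i) + 1"
  unfolding support_eq
proof (rule card_Union_connected_edges)
  show "cls i \<noteq> {}" using assms by (auto simp: T_def)
  show "\<exists>x\<in>D. \<exists>y\<in>cls i - D. x \<inter> y \<noteq> {}" if "D \<subset> cls i" "D \<noteq> {}" for D
    using that unfolding cls_def by (rule connected)
qed (use finite_cls edge_card in \<open>auto simp: cls_def\<close>)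

lemma card_support_ge:
  assumes "i \<in> T" shows "3 \<le> card {v \<in> V. 0 < dg i v}"
proof (rule ccontr)
  assume "\<not> 3 \<le> card {v \<in> V. 0 < dg i v}"
  then have le: "card (\<Union>(cls i)) \<le> 2" unfolding support_eq by simp
  have fin: "finite (\<Union>(cls i))" using finite_subset[OF _ finite_V] support_eq[of i] by blast
  have "x = \<Union>(cls i)" if "x \<in> cls i" for x
    using card_seteq[OF fin, of x] that le edge_card[of x] by (auto simp: cls_def)
  then have "cls i \<subseteq> {\<Union>(cls i)}" by blast
  then have "card (cls i) \<le> 1" using card_mono[of "{\<Union>(cls i)}" "cls i"] by simp
  then show False using assms by (auto simp: T_def)
qed

text \<open>Every path other than \<open>[u, v]\<close> has its colour in \<open>T\<close>, so it
  can leave \<open>A\<close> only through an interior vertex in \<open>R\<close>, and disjoint paths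
  use different ones. The path \<open>[u, v]\<close> may escape by a trivial colour, hence
  \<open>k - 1\<close>.\<close>

lemma separator_bound:
  assumes "A \<subseteq> V" "R \<subseteq> V" "A \<inter> R = {}" "u \<in> A" "v \<in> V - A - R"
    and step: "\<And>x y. \<lbrakk>x \<in> A; y \<in> V; adj x y\<rbrakk> \<Longrightarrow> y \<in> A \<union> R"
  shows "k - 1 \<le> card R"
proof -
  have u: "u \<in> V" and v: "v \<in> V" and uv: "u \<noteq> v" using assms by auto
  obtain P where P: "finite P" "card P = k" "\<And>p. p \<in> P \<Longrightarrow> is_path V E u v p" "\<And>p. p \<in> P \<Longrightarrow> monochromatic c p"
    "\<And>p q. \<lbrakk>p \<in> P; q \<in> P; p \<noteq> q\<rbrakk> \<Longrightarrow> interior p \<inter> interior q = {}"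
    using family[OF u v uv] by metis
  have "\<exists>r. r \<in> R \<inter> interior p" if p: "p \<in> P - {[u, v]}" for p
  proof (rule ccontr)
    assume no: "\<nexists>r. r \<in> R \<inter> interior p"
    have pP: "is_path V E u v p" "monochromatic c p" "p \<noteq> [u, v]" using P p by auto
    have "set p \<inter> R = {}" using no interior_eq[OF pP(1) uv] assms(3-5) by auto
    then have "is_path (V - R) {x \<in> E. c x \<in> T} u v p"
      using pP long_path_nontrivial[OF pP(1) uv pP(2,3)] mono_edge_colour[OF pP(1) uv pP(2)]
      unfolding is_path_def by auto
    then have "v \<in> A" by (rule path_closed) (use assms(4) step in \<open>auto simp: adj_def\<close>)
    then show False using assms(5) by simp
  qed
  then obtain r where r: "\<And>p. p \<in> P - {[u, v]} \<Longrightarrow> r p \<in> R \<inter> interior p" by metis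
  have "inj_on r (P - {[u, v]})"
  proof (rule inj_onI, rule ccontr)
    fix p q assume "p \<in> P - {[u, v]}" "q \<in> P - {[u, v]}" "r p = r q" "p \<noteq> q"
    then show False using r[of p] r[of q] P(5)[of p q] by auto
  qed
  then have "card (P - {[u, v]}) \<le> card R"
    using r assms(2) finite_V finite_subset by (intro card_inj_on_le[of r]) auto
  moreover have "k - 1 \<le> card (P - {[u, v]})" using P(1,2) by (simp add: card_Diff_singleton_if)
  ultimately show ?thesis by simp
qed

text \<open>Let \<open>v\<close> be a neighbour of \<open>u\<close> in colour \<open>i\<close>. As
  \<open>u\<close> has only \<open>k\<close> edges of nontrivial colour, the \<open>k\<close> paths
  to \<open>v\<close> use all of them as first edges. The path starting with the other edge of
  colour \<open>i\<close> closes up to a Hamilton cycle, which leaves no interior vertex for the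
  path starting in colour \<open>j\<close>.\<close>

lemma no_hamilton_cycle:
  assumes i: "i \<in> T" and two: "\<And>v. v \<in> V \<Longrightarrow> dg i v = 2" and u: "u \<in> V" and k: "(\<Sum>i\<in>T. dg i u) = k"
    and j: "j \<in> T" "j \<noteq> i" "0 < dg j u"
  shows False
proof -
  obtain e0 e1 where e01: "{x \<in> cls i. u \<in> x} = {e0, e1}" "e0 \<noteq> e1"
    using two[OF u] unfolding dg_def card_2_iff by blast
  have "e0 \<in> {x \<in> cls i. u \<in> x}" "e1 \<in> {x \<in> cls i. u \<in> x}" unfolding e01(1) by simp_all
  then have e0: "e0 \<in> cls i" "u \<in> e0" and e1: "e1 \<in> cls i" "u \<in> e1" by simp_all
  obtain v where v: "e0 = {u, v}" "u \<noteq> v" "v \<in> V" using e0 edge_at[of e0 u] by (auto simp: cls_def)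
  obtain e2 where e2: "e2 \<in> cls j" "u \<in> e2" using j(3) by (auto simp: dg_pos_iff)
  obtain P where P: "finite P" "card P = k" "\<And>p. p \<in> P \<Longrightarrow> is_path V E u v p" "\<And>p. p \<in> P \<Longrightarrow> monochromatic c p"
    "\<And>p q. \<lbrakk>p \<in> P; q \<in> P; p \<noteq> q\<rbrakk> \<Longrightarrow> interior p \<inter> interior q = {}"
    using family[OF u v(3,2)] by metis
  have fe_uv: "first_edge [u, v] = e0" using v by (simp add: first_edge_def)
  have "first_edge ` P = {x \<in> E. u \<in> x \<and> c x \<in> T}"
  proof (rule card_subset_eq)
    show "first_edge ` P \<subseteq> {x \<in> E. u \<in> x \<and> c x \<in> T}"
    proof
      fix x assume "x \<in> first_edge ` P"
      then obtain p where p: "p \<in> P" "x = first_edge p" by auto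
      have "c x \<in> T"
        using long_path_nontrivial[OF P(3)[OF p(1)] v(2) P(4)[OF p(1)]] fe_uv e0 i p(2)
        by (cases "p = [u, v]") (auto simp: cls_def)
      then show "x \<in> {x \<in> E. u \<in> x \<and> c x \<in> T}"
        using first_edge_props(1,2)[OF P(3)[OF p(1)] v(2)] p(2) by auto
    qed
    show "card (first_edge ` P) = card {x \<in> E. u \<in> x \<and> c x \<in> T}"
      using first_edge_inj_on[OF P(3) v(2) P(5)] P(2) k sum_dg by (simp add: card_image)
  qed (use finite_E in simp)
  then have "e1 \<in> first_edge ` P" "e2 \<in> first_edge ` P"
    using e1 e2 i j by (auto simp: cls_def)
  then obtain p q where pq: "p \<in> P" "first_edge p = e1" "q \<in> P" "first_edge q = e2" by blast
  have pne: "p \<noteq> [u, v]" and qne: "q \<noteq> [u, v]" and neq: "p \<noteq> q"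
    using pq fe_uv e01(2) e0 e1 e2 j(2) by (auto simp: cls_def)
  note p = P(3)[OF pq(1)] and q = P(3)[OF pq(3)]
  define C where "C = cls i"
  define L where "L = length p"
  have p0: "p ! 0 = u" "p ! (L - 1) = v" and L2: "2 \<le> L"
    using p path_length_ge[OF p v(2)] by (auto simp: is_path_def L_def hd_conv_nth last_conv_nth)
  have "L \<noteq> 2"
  proof
    assume "L = 2"
    then have "p ! 1 = v" using p0 by simp
    then show False using first_edge_props(5)[OF p v(2)] pne by simp
  qed
  then have L: "3 \<le> L" using L2 by simp
  have pC: "{p ! m, p ! Suc m} \<in> C" if "Suc m < L" for m
    using that p mono_edge_colour[OF p v(2) P(4)[OF pq(1)], of m] pq(2) e1
    by (auto simp: C_def cls_def is_path_def L_def)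
  have idx: "p ! m = p ! l \<longleftrightarrow> m = l" if "m < L" "l < L" for m l
    using p that by (auto simp: is_path_def L_def nth_eq_iff_index_eq)
  text \<open>Together with \<open>e0\<close>, the path \<open>p\<close> closes up to a cycle, which uses up both edges of colour \<open>i\<close>
    at each of its vertices.\<close>
  have cyc: "\<exists>a b. a \<noteq> b \<and> {w, a} \<in> C \<and> {w, b} \<in> C \<and> a \<in> set p \<and> b \<in> set p" if w: "w \<in> set p" for w
  proof -
    obtain m where m: "m < L" "w = p ! m" using w by (auto simp: in_set_conv_nth L_def)
    have pick: ?thesis if l: "l < L" "l' < L" "l \<noteq> l'" "{w, p ! l} \<in> C" "{w, p ! l'} \<in> C" for l l'
    proof (intro exI conjI)
      show "p ! l \<noteq> p ! l'" using idx[OF l(1,2)] l(3) by simp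
    qed (use l in \<open>simp_all add: L_def\<close>)
    have close: "{p ! 0, p ! (L - 1)} \<in> C" using e0 v p0 by (simp add: C_def)
    consider "m = 0" | "m = L - 1" "m \<noteq> 0" | "0 < m" "Suc m < L" using m by linarith
    then show ?thesis
    proof cases
      case 1
      show ?thesis
        by (rule pick[of 1 "L - 1"]) (use pC[of 0] close 1 m L in simp_all)
    next
      case 2
      have "Suc (L - 2) = L - 1" using L by simp
      then have "{w, p ! (L - 2)} \<in> C" using pC[of "L - 2"] 2 m by (simp add: insert_commute)
      moreover have "{w, p ! 0} \<in> C" using close 2 m by (simp add: insert_commute)
      ultimately show ?thesis using pick[of "L - 2" 0] L by simp
    next
      case 3
      have "{w, p ! (m - 1)} \<in> C" using pC[of "m - 1"] 3 m by (simp add: insert_commute)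
      moreover have "{w, p ! Suc m} \<in> C" using pC[of m] 3 m by simp
      ultimately show ?thesis using pick[of "m - 1" "Suc m"] 3 by simp
    qed
  qed
  have pV: "set p \<subseteq> V" and uS: "u \<in> set p" using p by (auto simp: is_path_def)
  have closed: "x \<subseteq> set p" if x: "x \<in> C" "w \<in> x" "w \<in> set p" for x w
  proof -
    obtain a b where ab: "a \<noteq> b" "{w, a} \<in> C" "{w, b} \<in> C" "a \<in> set p" "b \<in> set p" using cyc[OF x(3)] by blast
    have "{{w, a}, {w, b}} \<subseteq> {x \<in> C. w \<in> x}" using ab by auto
    moreover have "card {{w, a}, {w, b}} = 2" using ab by (auto simp: doubleton_eq_iff)
    moreover have "card {x \<in> C. w \<in> x} = 2" using two[of w] x pV by (auto simp: dg_def C_def)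
    ultimately have "{{w, a}, {w, b}} = {x \<in> C. w \<in> x}"
      using finite_cls[of i] by (intro card_subset_eq) (auto simp: C_def)
    then have "x \<in> {{w, a}, {w, b}}" using x by simp
    then show ?thesis using ab x by auto
  qed
  \<comment> \<open>Connectedness of the class rules out a second cycle.\<close>
  have "{x \<in> C. x \<subseteq> set p} = C"
  proof (rule ccontr)
    assume "{x \<in> C. x \<subseteq> set p} \<noteq> C"
    moreover have "e0 \<in> {x \<in> C. x \<subseteq> set p}" using e0 closed[of e0 u] uS by (simp add: C_def)
    ultimately have "{x \<in> C. x \<subseteq> set p} \<subset> {x \<in> E. c x = i}" "{x \<in> C. x \<subseteq> set p} \<noteq> {}"
      unfolding C_def cls_def by auto
    from connected[OF this] obtain x y where "x \<in> C" "x \<subseteq> set p" "y \<in> C" "\<not> y \<subseteq> set p" "x \<inter> y \<noteq> {}"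
      by (auto simp: C_def cls_def)
    then show False using closed by blast
  qed
  moreover have "V \<subseteq> \<Union>C"
  proof
    fix w assume "w \<in> V"
    then show "w \<in> \<Union>C" using dg_pos_iff[of i w] two[of w] by (simp add: C_def)
  qed
  ultimately have "V \<subseteq> set p" by auto
  moreover have "q ! 1 \<in> V" "q ! 1 \<in> interior q" "q ! 1 \<noteq> u" "q ! 1 \<noteq> v"
    using first_edge_props[OF q v(2)] interior_eq[OF q v(2)] qne q by (auto simp: is_path_def)
  ultimately have "q ! 1 \<in> interior p \<inter> interior q" using interior_eq[OF p v(2)] by auto
  then show False using P(5)[OF pq(1,3) neq] by auto
qed

text \<open>The number of edges minus the number of colours is the sum of
  \<open>card (cls i) - 1\<close>, to which one-edge colours contribute nothing;
  \<open>edge_bound\<close> treats the rest.\<close>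

lemma colours_bound:
  assumes "k \<le> 5"
  shows "2 * int (card (c ` E)) \<le> 2 * int (card E) - int (k * card V) + 2"
proof -
  interpret D: separated_degree_system V T "\<lambda>i v. int (dg i v)" "\<lambda>i. int (card (cls i))" adj "int k"
  proof
    show "int k - 1 \<le> (\<Sum>i\<in>T. min (int (dg i u)) (int (dg i v)))" if "u \<in> V" "v \<in> V" "u \<noteq> v" for u v
      using path_count[OF that] by (simp add: of_bool_def flip: of_nat_min of_nat_sum split: if_splits)
    show "u \<noteq> v \<and> int k \<le> (\<Sum>i\<in>T. min (int (dg i u)) (int (dg i v)))" if "u \<in> V" "v \<in> V" "adj u v" for u v
    proof -
      have "u \<noteq> v" using that edge_card[of "{u, v}"] by (auto simp: adj_def)
      then show ?thesis using path_count[OF that(1,2)] that(3) by (simp flip: of_nat_min of_nat_sum)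
    qed
    show "int (card {v \<in> V. adj u v}) = (\<Sum>i\<in>T. int (dg i u))" if "u \<in> V" for u
      using card_adj[OF that] by simp
    show "(\<Sum>v\<in>V. int (dg i v)) = 2 * int (card (cls i))" for i
      using sum_dg_vertices[of i] by (metis of_nat_mult of_nat_numeral of_nat_sum)
    show "int k - 1 \<le> int (card R)" if "A \<subseteq> V" "R \<subseteq> V" "A \<inter> R = {}" "u \<in> A" "v \<in> V - A - R"
      "\<And>x y. \<lbrakk>x \<in> A; y \<in> V; adj x y\<rbrakk> \<Longrightarrow> y \<in> A \<union> R" for A R u v
    proof -
      have "k - 1 \<le> card R" by (rule separator_bound[OF that(1-5)]) (use that(6) in blast)
      then show ?thesis by linarith
    qed
    show False if "i \<in> T" "\<And>v. v \<in> V \<Longrightarrow> int (dg i v) = 2" "u \<in> V" "(\<Sum>i\<in>T. int (dg i u)) = int k"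
      "j \<in> T" "j \<noteq> i" "0 < int (dg j u)" for i u j
    proof (rule no_hamilton_cycle[OF that(1) _ that(3) _ that(5,6)])
      show "dg i v = 2" if "v \<in> V" for v using \<open>\<And>v. v \<in> V \<Longrightarrow> int (dg i v) = 2\<close>[OF that] by linarith
      show "(\<Sum>i\<in>T. dg i u) = k" using that(4) unfolding of_nat_sum[symmetric] of_nat_eq_iff .
      show "0 < dg j u" using that(7) by linarith
    qed
    show "int (card {v \<in> V. 0 < int (dg i v)}) \<le> int (card (cls i)) + 1" if "i \<in> T" for i
      using card_support_le[OF that] unfolding of_nat_0_less_iff by linarith
  qed (use finite_V finite_T k_ge card_V card_support_ge in auto)
  have "card E = (\<Sum>i\<in>c ` E. card (cls i))"
    using sum.image_gen[OF finite_E, of "\<lambda>_. 1 :: nat" c] by (simp add: cls_def)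
  then have "int (card E) = (\<Sum>i\<in>c ` E. 1 + (int (card (cls i)) - 1))" by simp
  also have "\<dots> = int (card (c ` E)) + (\<Sum>i\<in>c ` E. int (card (cls i)) - 1)"
    by (simp only: sum.distrib) simp
  also have "(\<Sum>i\<in>c ` E. int (card (cls i)) - 1) = (\<Sum>i\<in>T. int (card (cls i)) - 1)"
  proof (rule sum.mono_neutral_right)
    show "\<forall>i\<in>c ` E - T. int (card (cls i)) - 1 = 0"
    proof
      fix i assume i: "i \<in> c ` E - T"
      then have "cls i \<noteq> {}" "\<not> 2 \<le> card (cls i)" by (auto simp: T_def cls_def)
      then show "int (card (cls i)) - 1 = 0" using finite_cls[of i] card_gt_0_iff[of "cls i"] by linarith
    qed
  qed (use finite_E in \<open>auto simp: T_def\<close>)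
  finally have "int (card E) = int (card (c ` E)) + (\<Sum>i\<in>T. int (card (cls i)) - 1)" .
  moreover have "(\<Sum>i\<in>T. 2 * int (card (cls i)) - 2) = 2 * (\<Sum>i\<in>T. int (card (cls i)) - 1)"
    by (simp add: sum_distrib_left right_diff_distrib)
  ultimately show ?thesis using D.edge_bound assms by simp
qed

end

section \<open>The maximum number of colours\<close>

text \<open>The new colour of an edge is its component within its colour class. A component
  determines the old colour, so no colours are lost; consecutive edges of a path share a vertex, so
  monochromatic paths stay monochromatic.\<close>

lemma connected_recolouring:
  fixes c :: "'a set \<Rightarrow> 'c"
  assumes "graph V E" "mono_k_connected_colouring k V E c" "2 \<le> k" "k < card V"
  obtains c' :: "'a set \<Rightarrow> 'a set set" where "connected_colouring V E c' k" "card (c ` E) \<le> card (c' ` E)"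
proof -
  define r where "r = {(x, y). x \<in> E \<and> y \<in> E \<and> c x = c y \<and> x \<inter> y \<noteq> {}}"
  define c' where "c' x = r\<^sup>* `` {x}" for x
  have "sym r" by (auto simp: r_def sym_def)
  then have sym: "(y, x) \<in> r\<^sup>*" if "(x, y) \<in> r\<^sup>*" for x y using that sym_rtrancl[of r] by (meson symD)
  have c'_eq: "c' x = c' y \<longleftrightarrow> (x, y) \<in> r\<^sup>*" for x y
    unfolding c'_def using sym by (auto intro: rtrancl_trans)
  have c_eq: "c y = c x" if "(x, y) \<in> r\<^sup>*" for x y
    using that by induction (auto simp: r_def)
  have finE: "finite E" using graph_finite_edges[OF assms(1)] .
  have "c ` E = (\<lambda>X. c (SOME y. y \<in> X)) ` c' ` E"
  proof -
    have "c (SOME y. y \<in> c' x) = c x" for x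
    proof -
      have "x \<in> c' x" by (simp add: c'_def)
      then have "(SOME y. y \<in> c' x) \<in> c' x" by (rule someI)
      then show ?thesis using c_eq by (simp add: c'_def)
    qed
    then show ?thesis by (simp add: image_image)
  qed
  then have card_le: "card (c ` E) \<le> card (c' ` E)" using card_image_le[of "c' ` E"] finE by simp
  have mono: "monochromatic c' p" if p: "is_path V E u v p" "monochromatic c p" for u v p
  proof -
    have E: "{p ! i, p ! Suc i} \<in> E" if "Suc i < length p" for i using p(1) that by (simp add: is_path_def)
    have first: "c' {p ! i, p ! Suc i} = c' {p ! 0, p ! Suc 0}" if "Suc i < length p" for i
      using that
    proof (induction i)
      case (Suc i)
      have "c {p ! i, p ! Suc i} = c {p ! Suc i, p ! Suc (Suc i)}"
        using p(2)[unfolded monochromatic_def, rule_format, of i "Suc i"] Suc.prems by simp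
      then have "({p ! i, p ! Suc i}, {p ! Suc i, p ! Suc (Suc i)}) \<in> r"
        using E[of i] E[of "Suc i"] Suc.prems by (simp add: r_def)
      then have "c' {p ! i, p ! Suc i} = c' {p ! Suc i, p ! Suc (Suc i)}" unfolding c'_eq by blast
      then show ?case using Suc by simp
    qed simp
    show ?thesis
      unfolding monochromatic_def
    proof (intro allI impI)
      fix i j assume "Suc i < length p" "Suc j < length p"
      then show "c' {p ! i, p ! Suc i} = c' {p ! j, p ! Suc j}" using first[of i] first[of j] by simp
    qed
  qed
  have "connected_colouring V E c' k"
  proof
    show "mono_k_connected_colouring k V E c'"
      unfolding mono_k_connected_colouring_def
    proof (intro ballI impI)
      fix u v assume uv: "u \<in> V" "v \<in> V" "u \<noteq> v"
      note assms(2)[unfolded mono_k_connected_colouring_def, THEN bspec, OF uv(1), THEN bspec, OF uv(2), THEN mp, OF uv(3)]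
      then obtain P where P: "finite P \<and> card P = k \<and> (\<forall>p\<in>P. is_path V E u v p \<and> monochromatic c p) \<and>
        (\<forall>p\<in>P. \<forall>q\<in>P. p \<noteq> q \<longrightarrow> interior p \<inter> interior q = {})" ..
      then have "\<forall>p\<in>P. is_path V E u v p \<and> monochromatic c' p" using mono by blast
      then show "\<exists>P. finite P \<and> card P = k \<and> (\<forall>p\<in>P. is_path V E u v p \<and> monochromatic c' p) \<and>
          (\<forall>p\<in>P. \<forall>q\<in>P. p \<noteq> q \<longrightarrow> interior p \<inter> interior q = {})"
        using P by (intro exI[of _ P]) simp
    qed
    fix D i assume D: "D \<subset> {x \<in> E. c' x = i}" "D \<noteq> {}"
    show "\<exists>x\<in>D. \<exists>y\<in>{x \<in> E. c' x = i} - D. x \<inter> y \<noteq> {}"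
    proof (rule ccontr)
      assume no: "\<not> ?thesis"
      obtain x y where xy: "x \<in> D" "y \<in> E" "c' y = i" "y \<notin> D" using D by blast
      have "c' x = i" using D(1) xy(1) by blast
      then have "(x, y) \<in> r\<^sup>*" using xy(3) c'_eq by metis
      then have "y \<in> D"
      proof induction
        case (step a b)
        then have "c' a = i" using D(1) by blast
        moreover have "c' a = c' b" using step(2) unfolding c'_eq by blast
        ultimately show ?case using no step by (auto simp: r_def)
      qed (use xy in simp)
      then show False using xy by simp
    qed
  qed (use assms in auto)
  then show thesis using that card_le by blast
qed

text \<open>All edges of \<open>F\<close> get colour 0 and the others distinct positive colours, so
  the \<open>k\<close> disjoint paths inside \<open>F\<close> are monochromatic. Since
  \<open>F\<close> is nonempty, colour 0 does occur.\<close>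

lemma mono_k_connected_colouring_spanning_subgraph:
  assumes "graph V E" "F \<subseteq> E" "k_connected k V F" "1 \<le> k" "F \<noteq> {}"
  obtains c :: "'a set \<Rightarrow> nat" where "mono_k_connected_colouring k V E c" "card (c ` E) = card (E - F) + 1"
proof -
  have finE: "finite E" using graph_finite_edges[OF assms(1)] .
  have gF: "graph V F" using assms(1,2) unfolding graph_def by blast
  obtain h :: "'a set \<Rightarrow> nat" where h: "inj_on h (E - F)"
    using finite_imp_inj_to_nat_seg[of "E - F"] finE by blast
  define c where "c x = (if x \<in> F then 0 else Suc (h x))" for x
  have "c ` E = insert 0 (Suc ` h ` (E - F))"
    using assms(2,5) by (auto simp: c_def image_iff)
  moreover have "card (Suc ` h ` (E - F)) = card (E - F)"
    using h by (simp add: card_image)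
  ultimately have card_eq: "card (c ` E) = card (E - F) + 1" using finE by simp
  have "mono_k_connected_colouring k V E c"
    unfolding mono_k_connected_colouring_def
  proof (intro ballI impI)
    fix u v assume uv: "u \<in> V" "v \<in> V" "u \<noteq> v"
    from k_connected_disjoint_paths[OF gF assms(3,4) uv]
    obtain P where P: "finite P \<and> card P = k \<and> (\<forall>p\<in>P. is_path V F u v p) \<and>
      (\<forall>p\<in>P. \<forall>q\<in>P. p \<noteq> q \<longrightarrow> interior p \<inter> interior q = {})" ..
    have "is_path V E u v p \<and> monochromatic c p" if "is_path V F u v p" for p
      using that assms(2) by (auto simp: is_path_def monochromatic_def c_def)
    then show "\<exists>P. finite P \<and> card P = k \<and> (\<forall>p\<in>P. is_path V E u v p \<and> monochromatic c p) \<and>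
        (\<forall>p\<in>P. \<forall>q\<in>P. p \<noteq> q \<longrightarrow> interior p \<inter> interior q = {})"
      using P by (intro exI[of _ P]) simp
  qed
  then show thesis using that card_eq by blast
qed

theorem theorem3p1:
  fixes V :: "'a set" and E F :: "'a set set" and k n :: nat
  assumes "k \<in> {2, 3, 4, 5}"
    and "n > k"
    and "graph V E"
    and "card V = n"
    and "k_connected k V E"
    and "min_spanning_k_connected k V E F"
    and "card F = \<lceil>real (k * n) / 2\<rceil>"
  shows "int (mc k V E) = int (card E) - \<lceil>real (k * n) / 2\<rceil> + 1"
proof -
  let ?M = "\<lceil>real (k * n) / 2\<rceil>" and ?C = "{card (c ` E) | c :: 'a set \<Rightarrow> nat. mono_k_connected_colouring k V E c}"
  have k: "2 \<le> k" "k \<le> 5" using assms(1) by auto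
  have finE: "finite E" using graph_finite_edges[OF assms(3)] .
  have F: "F \<subseteq> E" "k_connected k V F" using assms(6) by (auto simp: min_spanning_k_connected_def)
  have "0 < k * n" using k assms(2) by simp
  then have "0 < real (k * n) / 2" by simp
  then have "0 < ?M" by linarith
  then have "0 < card F" using assms(7) by linarith
  then have "F \<noteq> {}" by auto
  then obtain c :: "'a set \<Rightarrow> nat" where c: "mono_k_connected_colouring k V E c" "card (c ` E) = card (E - F) + 1"
    using mono_k_connected_colouring_spanning_subgraph[OF assms(3) F] k by auto
  have "card F \<le> card E" using F finE by (simp add: card_mono)
  then have lower: "int (card (c ` E)) = int (card E) - ?M + 1"
    using c(2) F finE assms(7) by (simp add: card_Diff_subset finite_subset of_nat_diff)
  have upper: "int m \<le> int (card E) - ?M + 1" if m: "m \<in> ?C" for m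
  proof -
    obtain b :: "'a set \<Rightarrow> nat" where b: "mono_k_connected_colouring k V E b" "m = card (b ` E)"
      using m by blast
    obtain c' :: "'a set \<Rightarrow> 'a set set" where c': "connected_colouring V E c' k" "card (b ` E) \<le> card (c' ` E)"
      using connected_recolouring[OF assms(3) b(1) k(1)] assms(2,4) by auto
    have "2 * int (card (c' ` E)) \<le> 2 * int (card E) - int (k * n) + 2"
      using connected_colouring.colours_bound[OF c'(1) k(2)] assms(4) by simp
    moreover have "int m \<le> int (card (c' ` E))" using c'(2) b(2) by simp
    ultimately have "int (k * n) \<le> 2 * int (card E) - 2 * int m + 2" by linarith
    then have "real_of_int (int (k * n)) \<le> real_of_int (2 * int (card E) - 2 * int m + 2)"
      by (rule of_int_le_iff[THEN iffD2])
    then have "real (k * n) / 2 \<le> real_of_int (int (card E) - int m + 1)" by simp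
    \<comment> \<open>The right-hand side is an integer, so the left-hand side may be rounded
      up.\<close>
    then have "?M \<le> int (card E) - int m + 1" by (rule ceiling_le)
    then show ?thesis by simp
  qed
  have "finite ?C" by (rule finite_subset[of _ "{..card E}"]) (auto simp: card_image_le finE)
  moreover have "card (c ` E) \<in> ?C" using c(1) by blast
  moreover have "m \<le> card (c ` E)" if "m \<in> ?C" for m using upper[OF that] lower by linarith
  ultimately have "Max ?C = card (c ` E)" by (intro Max_eqI) auto
  then show ?thesis using lower by (simp add: mc_def)
qed

end
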